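(* Fix $k\ge1$, $T>0$ and $\nu\ge0$. For every sufficiently large odd integer $\lambda$, every $\boldsymbol x=(x_1,\ldots,x_k)\in\operatorname{Conf}_k(\mathbb T^3)\setminus\Sigma_{\lambda,k}$, and every collection $F_1^*,\ldots,F_k^*$ of real symmetric positive-definite $3\times3$ matrices of determinant one, there is one exact real-analytic periodic unforced solution on $\mathbb T^3$, of the Euler equations if $\nu=0$ and of the Navier--Stokes equations with viscosity $\nu$ if $\nu>0$, whose Lagrangian flow $X$ satisfies $$X(x_\ell,t)=x_\ell\quad(0\le t\le T),\qquad\nabla_aX(x_\ell,T)=F_\ell^*\qquad(1\le\ell\le k).$$
   Context: $\mathbb T^3=(\mathbb R/2\pi\mathbb Z)^3$. The equations are $\partial_tu+u\cdot\nabla u+\nabla p=\nu\Delta u$, $\nabla\cdot u=0$, with no external force. The Lagrangian flow is defined by $\partial_tX(a,t)=u(X(a,t),t)$, $X(a,0)=a$, and $\nabla_aX$ is its Jacobian matrix in $a$. $\operatorname{Conf}_k(\mathbb T^3)=\{(x_1,\ldots,x_k)\in(\mathbb T^3)^k:x_i\ne x_j\text{ for }i\ne j\}$. $\operatorname{Sym}_0(3)$ is the space of trace-free real symmetric $3\times3$ matrices and $\operatorname{sym}A=\frac12(A+A^\top)$. $E_\lambda^+=\{W\in C^\omega(\mathbb T^3;\mathbb R^3):\nabla\times W=\lambda W\}$. The jet map $\mathcal J_{\lambda,\boldsymbol x}:E_\lambda^+\to(\mathbb R^3\oplus\operatorname{Sym}_0(3))^k$ is $\mathcal J_{\lambda,\boldsymbol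 x}W=(W(x_\ell),\operatorname{sym}\nabla W(x_\ell))_{\ell=1}^k$, and $\Sigma_{\lambda,k}=\{\boldsymbol x\in\operatorname{Conf}_k(\mathbb T^3):\operatorname{rank}\mathcal J_{\lambda,\boldsymbol x}<8k\}$. *)

theory Defs
  imports "HOL-Analysis.Analysis"
begin

text \<open>
  A point of the torus \<open>(\<real> / 2\<pi>\<int>)\<^sup>3\<close> is given by a representative in \<^typ>\<open>real^3\<close>, a function on the
  torus by its periodic lift, and a map of the torus isotopic to the identity (the Lagrangian flow)
  by its lift that starts from the identity.
\<close>

definition torus_eq :: "real^3 \<Rightarrow> real^3 \<Rightarrow> bool" where
  "torus_eq x y \<longleftrightarrow> (\<forall>i. \<exists>m::int. x $ i - y $ i = 2 * pi * of_int m)"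

definition torus_periodic :: "(real^3 \<Rightarrow> 'b) \<Rightarrow> bool" where
  "torus_periodic f \<longleftrightarrow> (\<forall>x y. torus_eq x y \<longrightarrow> f x = f y)"

text \<open>
  Real analyticity: local expansion in an unconditionally convergent power series, with
  multi-indices \<open>\<alpha> : Basis \<rightarrow> \<nat>\<close>. On a set that is not open, such as \<open>\<real>\<^sup>3 \<times> [0,\<infinity>)\<close>, this is
  analyticity up to the boundary.
\<close>

definition real_analytic_on ::
    "('a::euclidean_space \<Rightarrow> 'b::real_normed_vector) \<Rightarrow> 'a set \<Rightarrow> bool" where
  "real_analytic_on f S \<longleftrightarrow>
     (\<forall>x\<in>S. \<exists>r>0. \<exists>c::('a \<Rightarrow> nat) \<Rightarrow> 'b. \<forall>y \<in> S \<inter> ball x r.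
        ((\<lambda>\<alpha>. (\<Prod>b\<in>Basis. ((y - x) \<bullet> b) ^ \<alpha> b) *\<^sub>R c \<alpha>) has_sum f y) (Basis \<rightarrow>\<^sub>E UNIV))"

definition partial :: "3 \<Rightarrow> (real^3 \<Rightarrow> 'b::real_normed_vector) \<Rightarrow> real^3 \<Rightarrow> 'b" where
  "partial i f x = frechet_derivative f (at x) (axis i 1)"

definition grad :: "(real^3 \<Rightarrow> real) \<Rightarrow> real^3 \<Rightarrow> real^3" where
  "grad p x = (\<chi> i. partial i p x)"

definition divergence :: "(real^3 \<Rightarrow> real^3) \<Rightarrow> real^3 \<Rightarrow> real" where
  "divergence v x = (\<Sum>i\<in>UNIV. partial i v x $ i)"

definition laplacian :: "(real^3 \<Rightarrow> real^3) \<Rightarrow> real^3 \<Rightarrow> real^3" where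
  "laplacian v x = (\<Sum>i\<in>UNIV. partial i (partial i v) x)"

definition curl :: "(real^3 \<Rightarrow> real^3) \<Rightarrow> real^3 \<Rightarrow> real^3" where
  "curl v x = vector
     [partial 2 v x $ 3 - partial 3 v x $ 2,
      partial 3 v x $ 1 - partial 1 v x $ 3,
      partial 1 v x $ 2 - partial 2 v x $ 1]"

definition advect :: "(real^3 \<Rightarrow> real^3) \<Rightarrow> (real^3 \<Rightarrow> real^3) \<Rightarrow> real^3 \<Rightarrow> real^3" where
  "advect u v x = (\<Sum>i\<in>UNIV. u x $ i *\<^sub>R partial i v x)"

text \<open>
  Classical unforced solution on the torus for all times \<open>t \<ge> 0\<close>, real analytic in \<open>(x,t)\<close>.
  For \<open>\<nu> = 0\<close> these are the Euler equations, for \<open>\<nu> > 0\<close> the Navier--Stokes equations. The time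
  derivative is one-sided at \<open>t = 0\<close>.
\<close>

definition analytic_fluid_solution ::
    "real \<Rightarrow> (real^3 \<Rightarrow> real \<Rightarrow> real^3) \<Rightarrow> (real^3 \<Rightarrow> real \<Rightarrow> real) \<Rightarrow> bool" where
  "analytic_fluid_solution \<nu> u p \<longleftrightarrow>
     real_analytic_on (\<lambda>(x, t). u x t) (UNIV \<times> {0..}) \<and>
     real_analytic_on (\<lambda>(x, t). p x t) (UNIV \<times> {0..}) \<and>
     (\<forall>t\<ge>0. torus_periodic (\<lambda>x. u x t) \<and> torus_periodic (\<lambda>x. p x t)) \<and>
     (\<forall>x. \<forall>t\<ge>0.
        vector_derivative (u x) (at t within {0..})
          + advect (\<lambda>y. u y t) (\<lambda>y. u y t) x + grad (\<lambda>y. p y t) x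
        = \<nu> *\<^sub>R laplacian (\<lambda>y. u y t) x) \<and>
     (\<forall>x. \<forall>t\<ge>0. divergence (\<lambda>y. u y t) x = 0)"

definition lagrangian_flow ::
    "(real^3 \<Rightarrow> real \<Rightarrow> real^3) \<Rightarrow> (real^3 \<Rightarrow> real \<Rightarrow> real^3) \<Rightarrow> bool" where
  "lagrangian_flow u X \<longleftrightarrow>
     (\<forall>a. X a 0 = a \<and>
        (\<forall>t\<ge>0. (X a has_vector_derivative u (X a t) t) (at t within {0..})))"

text \<open>The finite index type \<open>'k\<close> plays the role of \<open>{1,\<dots>,k}\<close>, so \<open>k = CARD('k) \<ge> 1\<close>.\<close>

definition Conf :: "(real^3^'k) set" where
  "Conf = {x. \<forall>i j. i \<noteq> j \<longrightarrow> \<not> torus_eq (x $ i) (x $ j)}"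

definition beltrami_space :: "real \<Rightarrow> (real^3 \<Rightarrow> real^3) set" where
  "beltrami_space lam =
     {W. torus_periodic W \<and> real_analytic_on W UNIV \<and> (\<forall>x. curl W x = lam *\<^sub>R W x)}"

definition sym_part :: "real^3^3 \<Rightarrow> real^3^3" where
  "sym_part A = (1 / 2) *\<^sub>R (A + transpose A)"

text \<open>
  The jet map is typed with values in \<open>(\<real>\<^sup>3 \<times> \<real>\<^bsup>3\<times>3\<^esup>)\<^sup>k\<close>, which contains
  \<open>(\<real>\<^sup>3 \<oplus> Sym\<^sub>0(3))\<^sup>k\<close>; this does not affect its rank, the dimension of its image.
\<close>

definition jet_map :: "real^3^'k \<Rightarrow> (real^3 \<Rightarrow> real^3) \<Rightarrow> ((real^3) \<times> (real^3^3))^'k" where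
  "jet_map x W = (\<chi> l. (W (x $ l), sym_part (jacobian W (at (x $ l)))))"

definition jet_rank :: "real \<Rightarrow> real^3^'k \<Rightarrow> nat" where
  "jet_rank lam x = dim (jet_map x ` beltrami_space lam)"

definition Sigma_set :: "real \<Rightarrow> (real^3^'k) set" where
  "Sigma_set lam = {x \<in> Conf. jet_rank lam x < 8 * CARD('k)}"

definition sym_pos_def :: "real^3^3 \<Rightarrow> bool" where
  "sym_pos_def A \<longleftrightarrow> transpose A = A \<and> (\<forall>v. v \<noteq> 0 \<longrightarrow> v \<bullet> (A *v v) > 0)"

end

theory Submission
  imports Defs
begin

text \<open>
  On a Beltrami field \<open>W\<close> the nonlinearity \<open>(W \<cdot> \<nabla>) W = \<nabla> (|W|\<^sup>2 / 2)\<close> is a gradient and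
  \<open>\<Delta> W = - \<lambda>\<^sup>2 W\<close>, so \<open>u(x,t) = e\<^bsup>-\<nu>\<lambda>\<^sup>2t\<^esup> W(x)\<close> is an exact solution, whose flow is the flow of \<open>W\<close>
  run with the clock \<open>s(t) = \<integral>\<^sub>0\<^sup>t e\<^bsup>-\<nu>\<lambda>\<^sup>2r\<^esup> dr\<close>. Off \<open>\<Sigma>\<close> the jet map is onto, so there is such a \<open>W\<close>
  that vanishes at every \<open>x\<^sub>l\<close> with symmetric gradient \<open>S\<^sub>l = log F\<^sub>l / s(T)\<close>, trace-free because
  \<open>det F\<^sub>l = 1\<close>; its gradient there is \<open>S\<^sub>l\<close> itself because \<open>\<nabla> \<times> W = \<lambda> W\<close> vanishes. The points \<open>x\<^sub>l\<close>
  are then stationary and the Jacobian of the flow at time \<open>T\<close> is \<open>exp (s(T) S\<^sub>l) = F\<^sub>l\<close>.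
\<close>

section \<open>Real analytic functions\<close>

text \<open>Analyticity is given only as local unconditional convergence of power series, so it must
  first supply the calculus: differentiability, and equality of mixed derivatives, on which
  \<open>divergence_zero\<close> and \<open>laplacian_eq\<close> rest. Periodicity then bounds the
  first derivatives, so \<open>W\<close> is globally Lipschitz and its flow exists for all times t
  >= 0. Differentiability of the flow in its starting point is needed only at zeros of
  \<open>W\<close>. There the Jacobian of \<open>W\<close> is symmetric, hence has an orthonormal
  eigenbasis, and each eigencoordinate of the flow obeys a scalar estimate; this replaces the
  general theorem on dependence on initial data. The same kind of basis replaces the matrix
  logarithm and exponential: for F = Q diag(d) Q^T one takes Q diag(ln d / tau) Q^T with tau = s(T).
  Surjectivity of the jet map is a dimension count: rank at least 8k off Sigma, against at most 3 +
  5 = 8 dimensions per point for a vector and a trace-free symmetric matrix.\<close>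

abbreviation multi_indices :: "('a::euclidean_space \<Rightarrow> nat) set" where
  "multi_indices \<equiv> Basis \<rightarrow>\<^sub>E UNIV"

definition monomial :: "('a::euclidean_space \<Rightarrow> nat) \<Rightarrow> 'a \<Rightarrow> real" where
  "monomial \<alpha> y = (\<Prod>b\<in>Basis. (y \<bullet> b) ^ \<alpha> b)"

definition power_series_at ::
    "(('a::euclidean_space \<Rightarrow> nat) \<Rightarrow> 'b::euclidean_space) \<Rightarrow> 'a \<Rightarrow> real \<Rightarrow> ('a \<Rightarrow> 'b) \<Rightarrow> bool" where
  "power_series_at c x r f \<longleftrightarrow>
     0 < r \<and> (\<forall>y\<in>ball x r. ((\<lambda>\<alpha>. monomial \<alpha> (y - x) *\<^sub>R c \<alpha>) has_sum f y) multi_indices)"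

text \<open>Coefficients of the formal partial derivative along \<open>b\<close>. Keeping the
  operation formal allows mixed derivatives to be compared coefficientwise.\<close>

definition coeff_deriv ::
    "'a::euclidean_space \<Rightarrow> (('a \<Rightarrow> nat) \<Rightarrow> 'b::real_vector) \<Rightarrow> ('a \<Rightarrow> nat) \<Rightarrow> 'b" where
  "coeff_deriv b c \<alpha> = real (Suc (\<alpha> b)) *\<^sub>R c (\<alpha>(b := Suc (\<alpha> b)))"

section \<open>Term-by-term differentiation of power series\<close>

lemma real_analytic_on_UNIV_iff:
  "real_analytic_on f UNIV \<longleftrightarrow> (\<forall>x. \<exists>c r. power_series_at c x r f)"
  unfolding real_analytic_on_def power_series_at_def monomial_def by simp blast

lemma monomial_upd:
  assumes "b \<in> Basis"
  shows "monomial (\<alpha>(b := n)) y = (y \<bullet> b) ^ n * (\<Prod>b'\<in>Basis - {b}. (y \<bullet> b') ^ \<alpha> b')"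
  unfolding monomial_def using assms by (subst prod.remove[of _ b]) auto

lemma has_derivative_monomial:
  "((\<lambda>y. monomial \<alpha> (y - x)) has_derivative
     (\<lambda>h. \<Sum>b\<in>Basis. (h \<bullet> b) * (real (\<alpha> b) * monomial (\<alpha>(b := \<alpha> b - 1)) (y - x)))) (at y within S)"
proof -
  have "((\<lambda>y. \<Prod>b\<in>Basis. ((y - x) \<bullet> b) ^ \<alpha> b) has_derivative
     (\<lambda>h. \<Sum>b\<in>Basis. (real (\<alpha> b) * (h \<bullet> b) * ((y - x) \<bullet> b) ^ (\<alpha> b - 1)) *
        (\<Prod>b'\<in>Basis - {b}. ((y - x) \<bullet> b') ^ \<alpha> b'))) (at y within S)"
    by (rule has_derivative_prod) (auto intro!: derivative_eq_intros simp: fun_eq_iff)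
  then show ?thesis
    by (simp add: monomial_upd monomial_def[of \<alpha>] mult_ac cong: sum.cong)
qed

text \<open>In finite dimension unconditional convergence is absolute: this holds for each real
  coordinate, and the sum of the absolute coordinates dominates the norm.\<close>

lemma norm_summable_on_euclidean:
  fixes f :: "'i \<Rightarrow> 'b::euclidean_space"
  assumes "f summable_on A"
  shows "(\<lambda>i. norm (f i)) summable_on A"
proof (rule summable_on_comparison_test)
  have "(\<lambda>i. \<bar>f i \<bullet> b\<bar>) summable_on A" for b
    using summable_on_bounded_linear[OF bounded_linear_inner_left assms, of b]
    by (subst (asm) summable_on_iff_abs_summable_on_real) (simp add: o_def)
  note component = this
  have "finite B \<Longrightarrow> (\<lambda>i. \<Sum>b\<in>B. \<bar>f i \<bullet> b\<bar>) summable_on A" for B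
    by (induction B rule: finite_induct) (auto intro!: summable_on_add component)
  then show "(\<lambda>i. \<Sum>b\<in>Basis. \<bar>f i \<bullet> b\<bar>) summable_on A"
    by simp
qed (auto intro: norm_le_l1)

lemma infinite_multi_indices: "infinite (multi_indices :: ('a::euclidean_space \<Rightarrow> nat) set)"
proof -
  obtain b :: 'a where b: "b \<in> Basis" using nonempty_Basis by blast
  have "inj (\<lambda>n::nat. \<lambda>b\<in>(Basis::'a set). n)"
    by (rule injI) (metis b restrict_apply')
  moreover have "range (\<lambda>n::nat. \<lambda>b\<in>(Basis::'a set). n) \<subseteq> multi_indices" by auto
  ultimately show ?thesis
    by (meson infinite_iff_countable_subset)
qed

lemma countable_multi_indices: "countable (multi_indices :: ('a::euclidean_space \<Rightarrow> nat) set)"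
  by (intro countable_PiE) auto

lemma multi_indices_upd: "\<alpha> \<in> multi_indices \<Longrightarrow> b \<in> Basis \<Longrightarrow> \<alpha>(b := n) \<in> multi_indices"
  by (auto simp: PiE_iff extensional_def)

text \<open>At the diagonal point whose coordinates all equal \<open>\<rho>\<close> every monomial
  is positive; absolute convergence there yields a majorant for the series near
  \<open>x\<close>.\<close>

lemma power_series_norm_summable:
  assumes "power_series_at c x r f"
  obtains \<rho> where "0 < \<rho>" "\<rho> \<le> r" "(\<lambda>\<alpha>. (\<Prod>b\<in>Basis. \<rho> ^ \<alpha> b) * norm (c \<alpha>)) summable_on multi_indices"
proof -
  \<comment> \<open>The extra 1 makes the sum of the \<open>DIM('a)\<close> coordinates of
    \<open>z\<close> strictly less than \<open>r\<close>, so \<open>x + z\<close> stays in the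
    ball.\<close>
  define \<rho> where "\<rho> = r / (DIM('a) + 1)"
  define z :: 'a where "z = (\<Sum>b\<in>Basis. \<rho> *\<^sub>R b)"
  have r: "0 < r" using assms by (simp add: power_series_at_def)
  have \<rho>: "0 < \<rho>" "\<rho> \<le> r" using r by (auto simp: \<rho>_def field_simps)
  have "norm z \<le> (\<Sum>b\<in>(Basis::'a set). \<rho>)"
    unfolding z_def using \<rho> by (intro order_trans[OF norm_sum] sum_mono) auto
  also have "\<dots> < r" using r by (simp add: \<rho>_def field_simps)
  finally have "x + z \<in> ball x r" by (simp add: dist_norm)
  then have "((\<lambda>\<alpha>. monomial \<alpha> (x + z - x) *\<^sub>R c \<alpha>) has_sum f (x + z)) multi_indices"
    using assms unfolding power_series_at_def by blast
  then have "(\<lambda>\<alpha>. norm (monomial \<alpha> z *\<^sub>R c \<alpha>)) summable_on multi_indices"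
    by (intro norm_summable_on_euclidean) (auto simp: summable_on_def)
  moreover have "monomial \<alpha> z = (\<Prod>b\<in>Basis. \<rho> ^ \<alpha> b)" for \<alpha>
    by (auto simp: monomial_def z_def inner_sum_left_Basis intro!: prod.cong)
  ultimately show thesis using \<rho> that by (auto simp: abs_prod)
qed

text \<open>Pays for the factor \<open>n\<close> that differentiation produces, once the radius is
  halved.\<close>

lemma real_mult_half_power_le: "real n * (1 / 2) ^ (n - 1) \<le> 2"
proof (cases n)
  case (Suc m)
  have "real (Suc m) \<le> 2 ^ Suc m" by (metis less_imp_le of_nat_less_two_power)
  then show ?thesis using Suc by (simp add: field_simps)
qed auto

text \<open>In direction \<open>b\<close> halving the radius absorbs the factor
  \<open>\<alpha> b\<close>; the other coordinates are simply bounded by \<open>\<rho>\<close>. Up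
  to \<open>2 / \<rho>\<close> the differentiated terms thus keep the majorant of the original
  series.\<close>

lemma monomial_deriv_bound:
  assumes "0 < \<rho>" and y: "norm y \<le> \<rho> / 2" and b: "b \<in> Basis"
  shows "\<bar>real (\<alpha> b) * monomial (\<alpha>(b := \<alpha> b - 1)) y\<bar> \<le> 2 / \<rho> * (\<Prod>b\<in>Basis. \<rho> ^ \<alpha> b)"
proof -
  have yb: "\<bar>y \<bullet> b'\<bar> \<le> \<rho> / 2" if "b' \<in> Basis" for b'
    using Basis_le_norm[OF that, of y] y by linarith
  have "real (\<alpha> b) * \<bar>y \<bullet> b\<bar> ^ (\<alpha> b - 1) \<le> real (\<alpha> b) * (\<rho> / 2) ^ (\<alpha> b - 1)"
    using yb[OF b] by (intro mult_left_mono power_mono) auto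
  also have "\<dots> = (real (\<alpha> b) * (1 / 2) ^ (\<alpha> b - 1)) * \<rho> ^ (\<alpha> b - 1)"
    by (simp add: power_divide)
  also have "\<dots> \<le> 2 / \<rho> * \<rho> ^ \<alpha> b"
  proof (cases "\<alpha> b")
    case (Suc m)
    then show ?thesis
      using assms(1) mult_right_mono[OF real_mult_half_power_le[of "\<alpha> b"], of "\<rho> ^ m"]
      by simp
  qed (use assms(1) in auto)
  finally have 1: "real (\<alpha> b) * \<bar>y \<bullet> b\<bar> ^ (\<alpha> b - 1) \<le> 2 / \<rho> * \<rho> ^ \<alpha> b" .
  have "\<bar>\<Prod>b'\<in>Basis - {b}. (y \<bullet> b') ^ \<alpha> b'\<bar> \<le> (\<Prod>b'\<in>Basis - {b}. \<rho> ^ \<alpha> b')"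
    unfolding abs_prod power_abs
    using assms(1) by (intro prod_mono conjI power_mono) (auto dest!: yb)
  with 1 have "real (\<alpha> b) * \<bar>y \<bullet> b\<bar> ^ (\<alpha> b - 1) * \<bar>\<Prod>b'\<in>Basis - {b}. (y \<bullet> b') ^ \<alpha> b'\<bar>
      \<le> (2 / \<rho> * \<rho> ^ \<alpha> b) * (\<Prod>b'\<in>Basis - {b}. \<rho> ^ \<alpha> b')"
    using assms(1) by (intro mult_mono[of "real (\<alpha> b) * \<bar>y \<bullet> b\<bar> ^ (\<alpha> b - 1)"]) auto
  also have "\<dots> = 2 / \<rho> * (\<Prod>b\<in>Basis. \<rho> ^ \<alpha> b)"
    using b by (subst prod.remove[of Basis b]) auto
  finally show ?thesis
    by (simp add: monomial_upd[OF b] abs_mult power_abs mult_ac)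
qed

text \<open>The majorant at radius \<open>\<rho>\<close> gives, on the ball of half that radius,
  uniform convergence of the differentiated series by the Weierstrass test.\<close>

lemma power_series_has_derivative:
  assumes ps: "power_series_at c x r f"
  obtains s D where "0 < s"
    "\<And>b y. b \<in> Basis \<Longrightarrow> y \<in> ball x s \<Longrightarrow>
      ((\<lambda>\<alpha>. (real (\<alpha> b) * monomial (\<alpha>(b := \<alpha> b - 1)) (y - x)) *\<^sub>R c \<alpha>) has_sum D b y) multi_indices"
    "\<And>y. y \<in> ball x s \<Longrightarrow> (f has_derivative (\<lambda>h. \<Sum>b\<in>Basis. (h \<bullet> b) *\<^sub>R D b y)) (at y)"
proof -
  obtain \<rho> where \<rho>: "0 < \<rho>" "\<rho> \<le> r"
    and sm: "(\<lambda>\<alpha>. (\<Prod>b\<in>Basis. \<rho> ^ \<alpha> b) * norm (c \<alpha>)) summable_on multi_indices"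
    using power_series_norm_summable[OF ps] .
  define M where "M \<alpha> = 2 / \<rho> * ((\<Prod>b\<in>Basis. \<rho> ^ \<alpha> b) * norm (c \<alpha>))" for \<alpha>
  have smM: "M summable_on multi_indices"
    unfolding M_def by (rule summable_on_cmult_right[OF sm])
  define s where "s = \<rho> / 2"
  define d where "d b \<alpha> y = (real (\<alpha> b) * monomial (\<alpha>(b := \<alpha> b - 1)) (y - x)) *\<^sub>R c \<alpha>" for b \<alpha> y
  define D where "D b y = (\<Sum>\<^sub>\<infinity>\<alpha>\<in>multi_indices. d b \<alpha> y)" for b y
  have dM: "norm (d b \<alpha> y) \<le> M \<alpha>" if "b \<in> Basis" "y \<in> ball x s" for b \<alpha> y
  proof -
    have "norm (y - x) \<le> \<rho> / 2" using that(2) by (simp add: s_def dist_norm norm_minus_commute)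
    from mult_right_mono[OF monomial_deriv_bound[OF \<rho>(1) this that(1), of \<alpha>] norm_ge_zero[of "c \<alpha>"]]
    show ?thesis by (simp add: d_def M_def mult.assoc)
  qed
  have smd: "(\<lambda>\<alpha>. d b \<alpha> y) summable_on multi_indices" if "b \<in> Basis" "y \<in> ball x s" for b y
    by (rule abs_summable_summable, rule summable_on_comparison_test[OF smM]) (use dM that in auto)
  have hsd: "((\<lambda>\<alpha>. d b \<alpha> y) has_sum D b y) multi_indices" if "b \<in> Basis" "y \<in> ball x s" for b y
    unfolding D_def using smd[OF that] by simp
  \<comment> \<open>The Weierstrass test and \<open>has_derivative_series\<close> concern sequences,
    so the multi-indices are enumerated; unconditional sums do not depend on the order.\<close>
  obtain e :: "nat \<Rightarrow> 'a \<Rightarrow> nat" where e: "bij_betw e UNIV multi_indices"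
    using countableE_infinite[OF countable_multi_indices infinite_multi_indices]
    by (metis bij_betw_inv_into)
  have eM: "e n \<in> multi_indices" for n using bij_betw_apply[OF e, of n] by simp
  have "summable (\<lambda>n. M (e n))"
    using smM summable_on_reindex_bij_betw[OF e, of M] summable_on_UNIV_nonneg_real_iff
    by (meson summable_on_imp_summable)
  then have lim: "uniform_limit (ball x s) (\<lambda>n y. \<Sum>i<n. d b (e i) y) (\<lambda>y. \<Sum>i. d b (e i) y) sequentially"
    if "b \<in> Basis" for b
    using that by (intro Weierstrass_m_test[where M = "\<lambda>n. M (e n)"]) (auto intro: dM)
  have sumD: "(\<Sum>i. d b (e i) y) = D b y" if "b \<in> Basis" "y \<in> ball x s" for b y
    using hsd[OF that]
    by (subst (asm) has_sum_reindex_bij_betw[OF e, symmetric])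
      (rule sums_unique[symmetric, OF has_sum_imp_sums])
  have x: "x \<in> ball x s" using \<rho> by (simp add: s_def)
  have sr: "s \<le> r" using \<rho> by (simp add: s_def)
  have fs: "(\<lambda>n. monomial (e n) (y - x) *\<^sub>R c (e n)) sums f y" if "y \<in> ball x s" for y
  proof -
    have "y \<in> ball x r" using that sr by simp
    then have "((\<lambda>\<alpha>. monomial \<alpha> (y - x) *\<^sub>R c \<alpha>) has_sum f y) multi_indices"
      using ps unfolding power_series_at_def by blast
    then show ?thesis
      by (subst (asm) has_sum_reindex_bij_betw[OF e, symmetric]) (rule has_sum_imp_sums)
  qed
  have "\<exists>g. \<forall>y\<in>ball x s. (\<lambda>n. monomial (e n) (y - x) *\<^sub>R c (e n)) sums g y \<and>
      (g has_derivative (\<lambda>h. \<Sum>b\<in>Basis. (h \<bullet> b) *\<^sub>R D b y)) (at y within ball x s)"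
  proof (rule has_derivative_series[where x = x and
        f' = "\<lambda>n y h. \<Sum>b\<in>Basis. (h \<bullet> b) *\<^sub>R d b (e n) y"])
    fix n y
    show "((\<lambda>y. monomial (e n) (y - x) *\<^sub>R c (e n)) has_derivative
        (\<lambda>h. \<Sum>b\<in>Basis. (h \<bullet> b) *\<^sub>R d b (e n) y)) (at y within ball x s)"
      by (rule has_derivative_eq_rhs[OF has_derivative_scaleR_left[OF has_derivative_monomial]])
        (simp add: d_def scaleR_sum_left)
  next
    fix \<epsilon> :: real assume \<epsilon>: "\<epsilon> > 0"
    \<comment> \<open>An equal share of \<open>\<epsilon>\<close> for each coordinate
      direction.\<close>
    define \<delta> where "\<delta> = \<epsilon> / DIM('a)"
    have \<delta>: "0 < \<delta>" using \<epsilon> by (simp add: \<delta>_def)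
    have "\<forall>\<^sub>F n in sequentially. \<forall>b\<in>Basis. \<forall>y\<in>ball x s. norm ((\<Sum>i<n. d b (e i) y) - D b y) < \<delta>"
      using uniform_limitD[OF lim \<delta>] sumD
      by (intro eventually_ball_finite) (auto simp: dist_norm elim!: eventually_mono)
    then show "\<forall>\<^sub>F n in sequentially. \<forall>y\<in>ball x s. \<forall>h.
        norm ((\<Sum>i<n. \<Sum>b\<in>Basis. (h \<bullet> b) *\<^sub>R d b (e i) y) - (\<Sum>b\<in>Basis. (h \<bullet> b) *\<^sub>R D b y)) \<le> \<epsilon> * norm h"
    proof (eventually_elim, intro ballI allI)
      fix n y and h :: 'a
      assume *: "\<forall>b\<in>Basis. \<forall>y\<in>ball x s. norm ((\<Sum>i<n. d b (e i) y) - D b y) < \<delta>" and y: "y \<in> ball x s"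
      have "(\<Sum>i<n. \<Sum>b\<in>Basis. (h \<bullet> b) *\<^sub>R d b (e i) y) - (\<Sum>b\<in>Basis. (h \<bullet> b) *\<^sub>R D b y)
          = (\<Sum>b\<in>Basis. (h \<bullet> b) *\<^sub>R ((\<Sum>i<n. d b (e i) y) - D b y))"
        by (subst sum.swap) (simp add: scaleR_diff_right sum_subtractf scaleR_sum_right)
      also have "norm \<dots> \<le> (\<Sum>b\<in>(Basis::'a set). norm h * \<delta>)"
      proof (intro order_trans[OF norm_sum] sum_mono)
        fix b :: 'a assume b: "b \<in> Basis"
        have "norm ((\<Sum>i<n. d b (e i) y) - D b y) \<le> \<delta>" using * b y by (meson less_imp_le)
        then show "norm ((h \<bullet> b) *\<^sub>R ((\<Sum>i<n. d b (e i) y) - D b y)) \<le> norm h * \<delta>"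
          unfolding norm_scaleR using Basis_le_norm[OF b, of h]
          by (intro mult_mono) auto
      qed
      also have "\<dots> = \<epsilon> * norm h" by (simp add: \<delta>_def)
      finally show "norm ((\<Sum>i<n. \<Sum>b\<in>Basis. (h \<bullet> b) *\<^sub>R d b (e i) y) - (\<Sum>b\<in>Basis. (h \<bullet> b) *\<^sub>R D b y))
          \<le> \<epsilon> * norm h" .
    qed
  qed (use x fs[OF x] in auto)
  then obtain g where g: "\<And>y. y \<in> ball x s \<Longrightarrow> (\<lambda>n. monomial (e n) (y - x) *\<^sub>R c (e n)) sums g y"
      "\<And>y. y \<in> ball x s \<Longrightarrow>
        (g has_derivative (\<lambda>h. \<Sum>b\<in>Basis. (h \<bullet> b) *\<^sub>R D b y)) (at y within ball x s)"
    by blast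
  have "(f has_derivative (\<lambda>h. \<Sum>b\<in>Basis. (h \<bullet> b) *\<^sub>R D b y)) (at y)" if y: "y \<in> ball x s" for y
  proof -
    have "(g has_derivative (\<lambda>h. \<Sum>b\<in>Basis. (h \<bullet> b) *\<^sub>R D b y)) (at y)"
      using g(2)[OF y] at_within_open[OF y open_ball] by metis
    then show ?thesis
      by (rule has_derivative_transform_within_open[OF _ open_ball y])
        (metis g(1) fs sums_unique2)
  qed
  with x hsd show thesis
    by (intro that[of s D]) (auto simp: d_def)
qed

lemma power_series_deriv:
  assumes ps: "power_series_at c x r f"
  obtains s where "0 < s" "\<And>y. y \<in> ball x s \<Longrightarrow> f differentiable (at y)"
    "\<And>b. b \<in> Basis \<Longrightarrow>
      power_series_at (coeff_deriv b c) x s (\<lambda>y. frechet_derivative f (at y) b)"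
proof -
  obtain s D where s: "0 < s"
    and D: "\<And>b y. b \<in> Basis \<Longrightarrow> y \<in> ball x s \<Longrightarrow>
      ((\<lambda>\<alpha>. (real (\<alpha> b) * monomial (\<alpha>(b := \<alpha> b - 1)) (y - x)) *\<^sub>R c \<alpha>) has_sum D b y) multi_indices"
    and f: "\<And>y. y \<in> ball x s \<Longrightarrow> (f has_derivative (\<lambda>h. \<Sum>b\<in>Basis. (h \<bullet> b) *\<^sub>R D b y)) (at y)"
    by (rule power_series_has_derivative[OF ps]) (rule that)
  have frechet: "frechet_derivative f (at y) b = D b y" if "b \<in> Basis" "y \<in> ball x s" for b y
    using frechet_derivative_at[OF f[OF that(2)], symmetric] that(1)
    by (simp add: inner_Basis if_distrib[where f = "\<lambda>c. c *\<^sub>R _"] cong: if_cong)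
  have "((\<lambda>\<alpha>. monomial \<alpha> (y - x) *\<^sub>R coeff_deriv b c \<alpha>) has_sum D b y) multi_indices"
    if b: "b \<in> Basis" and y: "y \<in> ball x s" for b y
  proof -
    define u where "u \<alpha> = \<alpha>(b := Suc (\<alpha> b))" for \<alpha> :: "'a \<Rightarrow> nat"
    let ?t = "\<lambda>\<alpha>. (real (\<alpha> b) * monomial (\<alpha>(b := \<alpha> b - 1)) (y - x)) *\<^sub>R c \<alpha>"
    have inj: "inj_on u multi_indices"
      by (rule inj_onI, rule ext) (metis u_def fun_upd_apply nat.inject)
    have img: "u ` multi_indices = {\<alpha> \<in> multi_indices. \<alpha> b \<noteq> 0}"
    proof (intro set_eqI iffI)
      fix \<alpha> assume "\<alpha> \<in> {\<alpha> \<in> multi_indices. \<alpha> b \<noteq> 0}"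
      then have "\<alpha>(b := \<alpha> b - 1) \<in> multi_indices" "\<alpha> = u (\<alpha>(b := \<alpha> b - 1))"
        using b multi_indices_upd by (auto simp: u_def)
      then show "\<alpha> \<in> u ` multi_indices" by blast
    qed (use b multi_indices_upd in \<open>auto simp: u_def\<close>)
    \<comment> \<open>Terms with \<open>\<alpha> b = 0\<close> vanish, so the sum is carried by the
      image of the shift \<open>u\<close>; reindexing along \<open>u\<close> produces
      \<open>coeff_deriv b c\<close>.\<close>
    have "(?t has_sum D b y) (u ` multi_indices) \<longleftrightarrow> (?t has_sum D b y) multi_indices"
      unfolding img by (rule has_sum_cong_neutral) auto
    with D[OF b y] have "(?t has_sum D b y) (u ` multi_indices)" by simp
    then have "(?t \<circ> u has_sum D b y) multi_indices"
      by (simp add: has_sum_reindex[OF inj])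
    moreover have "?t \<circ> u = (\<lambda>\<alpha>. monomial \<alpha> (y - x) *\<^sub>R coeff_deriv b c \<alpha>)"
      by (simp add: u_def coeff_deriv_def mult.commute fun_eq_iff)
    ultimately show ?thesis by simp
  qed
  with s f frechet show thesis
    by (intro that[of s]) (auto simp: power_series_at_def differentiable_def)
qed

lemma coeff_deriv_commute: "coeff_deriv a (coeff_deriv b c) = coeff_deriv b (coeff_deriv a c)"
proof (cases "a = b")
  case False
  then show ?thesis
    by (auto simp: coeff_deriv_def fun_eq_iff fun_upd_twist mult.commute)
qed simp

text \<open>Evaluation at the centre is enough, because derivatives are compared at the very point
  about which the series are expanded.\<close>

lemma power_series_unique_value:
  assumes "power_series_at c x r f" "power_series_at c x s g"
  shows "f x = g x"
  using assms unfolding power_series_at_def by (meson centre_in_ball has_sum_unique)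

lemma real_analytic_imp_differentiable:
  fixes f :: "'a::euclidean_space \<Rightarrow> 'b::euclidean_space"
  assumes "real_analytic_on f UNIV"
  shows "f differentiable (at x)"
  using assms power_series_deriv centre_in_ball unfolding real_analytic_on_UNIV_iff by metis

lemma real_analytic_directional_derivative:
  fixes f :: "'a::euclidean_space \<Rightarrow> 'b::euclidean_space"
  assumes "real_analytic_on f UNIV" "b \<in> Basis"
  shows "real_analytic_on (\<lambda>y. frechet_derivative f (at y) b) UNIV"
  using assms power_series_deriv unfolding real_analytic_on_UNIV_iff by metis

text \<open>Both iterated derivatives are sums of series about \<open>x\<close> with the same
  coefficients, since formal differentiations commute.\<close>

lemma real_analytic_mixed_derivatives:
  fixes f :: "'a::euclidean_space \<Rightarrow> 'b::euclidean_space"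
  assumes "real_analytic_on f UNIV" and a: "a \<in> Basis" and b: "b \<in> Basis"
  shows "frechet_derivative (\<lambda>y. frechet_derivative f (at y) a) (at x) b
       = frechet_derivative (\<lambda>y. frechet_derivative f (at y) b) (at x) a"
proof -
  obtain c r where ps: "power_series_at c x r f"
    using assms(1) unfolding real_analytic_on_UNIV_iff by blast
  obtain s where s: "\<And>b. b \<in> Basis \<Longrightarrow>
      power_series_at (coeff_deriv b c) x s (\<lambda>y. frechet_derivative f (at y) b)"
    using power_series_deriv[OF ps] by metis
  obtain s1 where s1: "power_series_at (coeff_deriv b (coeff_deriv a c)) x s1
      (\<lambda>y. frechet_derivative (\<lambda>y. frechet_derivative f (at y) a) (at y) b)"
    using power_series_deriv[OF s[OF a]] b by metis
  obtain s2 where s2: "power_series_at (coeff_deriv a (coeff_deriv b c)) x s2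
      (\<lambda>y. frechet_derivative (\<lambda>y. frechet_derivative f (at y) b) (at y) a)"
    using power_series_deriv[OF s[OF b]] a by metis
  show ?thesis
    using s2 by (subst (asm) coeff_deriv_commute) (rule power_series_unique_value[OF s1])
qed

section \<open>Closure properties of real analytic functions\<close>

text \<open>Collects the terms that share a monomial, by summing over the fibres of
  \<open>e\<close>. It serves products, where \<open>e\<close> adds two multi-indices, and
  coordinate projections, where \<open>e\<close> extends one by zero.\<close>

lemma has_sum_regroup:
  fixes m :: "'k \<Rightarrow> real" and d :: "'i \<Rightarrow> 'b::real_normed_vector"
  assumes sum: "((\<lambda>i. m (e i) *\<^sub>R d i) has_sum s) I" and e: "e ` I \<subseteq> K"
    and fin: "\<And>k. k \<in> K \<Longrightarrow> finite {i \<in> I. e i = k}"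
  shows "((\<lambda>k. m k *\<^sub>R (\<Sum>i\<in>{i \<in> I. e i = k}. d i)) has_sum s) K"
proof (rule has_sum_SigmaD)
  have bij: "bij_betw (\<lambda>i. (e i, i)) I (Sigma K (\<lambda>k. {i \<in> I. e i = k}))"
    using e by (auto simp: bij_betw_def inj_on_def)
  show "((\<lambda>(k, i). m k *\<^sub>R d i) has_sum s) (Sigma K (\<lambda>k. {i \<in> I. e i = k}))"
    using has_sum_reindex_bij_betw[OF bij, of "\<lambda>(k, i). m k *\<^sub>R d i"] sum by simp
  show "((\<lambda>i. case (k, i) of (k, i) \<Rightarrow> m k *\<^sub>R d i) has_sum m k *\<^sub>R (\<Sum>i\<in>{i \<in> I. e i = k}. d i))
      {i \<in> I. e i = k}" if "k \<in> K" for k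
    using fin[OF that] by (intro has_sum_finiteI) (simp_all add: scaleR_sum_right)
qed

text \<open>The iterated sum gives the value; summability over the product set comes from absolute
  convergence of both factors.\<close>

lemma has_sum_scaleR_Times:
  fixes f :: "'i \<Rightarrow> real" and g :: "'j \<Rightarrow> 'b::euclidean_space"
  assumes f: "(f has_sum a) A" and g: "(g has_sum b) B"
  shows "((\<lambda>(i, j). f i *\<^sub>R g j) has_sum a *\<^sub>R b) (A \<times> B)"
proof (rule has_sum_SigmaI)
  show "((\<lambda>j. case (i, j) of (i, j) \<Rightarrow> f i *\<^sub>R g j) has_sum f i *\<^sub>R b) B" for i
    using has_sum_bounded_linear[OF bounded_linear_scaleR_right g, of "f i"] by (simp add: o_def)
  show "((\<lambda>i. f i *\<^sub>R b) has_sum a *\<^sub>R b) A"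
    using has_sum_bounded_linear[OF bounded_linear_scaleR_left f, of b] by (simp add: o_def)
  have f': "(\<lambda>i. norm (f i)) summable_on A" and g': "(\<lambda>j. norm (g j)) summable_on B"
    using f g norm_summable_on_euclidean has_sum_imp_summable by blast+
  have "(\<lambda>(i, j). norm (f i) * norm (g j)) summable_on A \<times> B"
  proof (rule summable_on_SigmaI)
    show "((\<lambda>j. case (i, j) of (i, j) \<Rightarrow> norm (f i) * norm (g j)) has_sum
        norm (f i) * (\<Sum>\<^sub>\<infinity>j\<in>B. norm (g j))) B" for i
      using g' by (auto intro: has_sum_cmult_right)
    show "(\<lambda>i. norm (f i) * (\<Sum>\<^sub>\<infinity>j\<in>B. norm (g j))) summable_on A"
      by (rule summable_on_cmult_left[OF f'])
  qed auto
  then have "(\<lambda>p. norm (case p of (i, j) \<Rightarrow> f i *\<^sub>R g j)) summable_on A \<times> B"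
    by (simp add: case_prod_unfold)
  then show "(\<lambda>(i, j). f i *\<^sub>R g j) summable_on A \<times> B"
    by (rule abs_summable_summable)
qed

lemma real_analytic_on_iff:
  "real_analytic_on f S \<longleftrightarrow>
     (\<forall>x\<in>S. \<exists>r>0. \<exists>c. \<forall>y \<in> S \<inter> ball x r.
        ((\<lambda>\<alpha>. monomial \<alpha> (y - x) *\<^sub>R c \<alpha>) has_sum f y) multi_indices)"
  unfolding real_analytic_on_def monomial_def ..

lemma real_analytic_on_subset: "real_analytic_on f S \<Longrightarrow> T \<subseteq> S \<Longrightarrow> real_analytic_on f T"
  unfolding real_analytic_on_iff by (meson Int_iff subsetD)

lemma real_analytic_on_bounded_linear:
  assumes h: "bounded_linear h" and "real_analytic_on f S"
  shows "real_analytic_on (\<lambda>x. h (f x)) S"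
  unfolding real_analytic_on_iff
proof
  fix x assume "x \<in> S"
  then obtain r c where r: "r > 0"
    "\<And>y. y \<in> S \<inter> ball x r \<Longrightarrow> ((\<lambda>\<alpha>. monomial \<alpha> (y - x) *\<^sub>R c \<alpha>) has_sum f y) multi_indices"
    using assms(2) unfolding real_analytic_on_iff by metis
  have "((\<lambda>\<alpha>. monomial \<alpha> (y - x) *\<^sub>R h (c \<alpha>)) has_sum h (f y)) multi_indices"
    if "y \<in> S \<inter> ball x r" for y
    using has_sum_bounded_linear[OF h r(2)[OF that]]
    by (simp add: o_def linear_cmul[OF bounded_linear.linear[OF h]])
  with r(1) show "\<exists>r>0. \<exists>c. \<forall>y \<in> S \<inter> ball x r.
        ((\<lambda>\<alpha>. monomial \<alpha> (y - x) *\<^sub>R c \<alpha>) has_sum h (f y)) multi_indices"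
    by (intro exI[of _ r] conjI exI[of _ "\<lambda>\<alpha>. h (c \<alpha>)"]) auto
qed

lemma real_analytic_on_add:
  assumes "real_analytic_on f S" "real_analytic_on g S"
  shows "real_analytic_on (\<lambda>x. f x + g x) S"
  unfolding real_analytic_on_iff
proof
  fix x assume x: "x \<in> S"
  obtain r c where r: "r > 0"
    "\<And>y. y \<in> S \<inter> ball x r \<Longrightarrow> ((\<lambda>\<alpha>. monomial \<alpha> (y - x) *\<^sub>R c \<alpha>) has_sum f y) multi_indices"
    using assms(1) x unfolding real_analytic_on_iff by metis
  obtain s d where s: "s > 0"
    "\<And>y. y \<in> S \<inter> ball x s \<Longrightarrow> ((\<lambda>\<alpha>. monomial \<alpha> (y - x) *\<^sub>R d \<alpha>) has_sum g y) multi_indices"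
    using assms(2) x unfolding real_analytic_on_iff by metis
  have "((\<lambda>\<alpha>. monomial \<alpha> (y - x) *\<^sub>R (c \<alpha> + d \<alpha>)) has_sum f y + g y) multi_indices"
    if "y \<in> S \<inter> ball x (min r s)" for y
    using has_sum_add[OF r(2) s(2), of y y] that by (simp add: scaleR_add_right)
  with r(1) s(1) show "\<exists>r>0. \<exists>c. \<forall>y \<in> S \<inter> ball x r.
        ((\<lambda>\<alpha>. monomial \<alpha> (y - x) *\<^sub>R c \<alpha>) has_sum f y + g y) multi_indices"
    by (intro exI[of _ "min r s"] conjI exI[of _ "\<lambda>\<alpha>. c \<alpha> + d \<alpha>"]) auto
qed

text \<open>Both summands are dominated componentwise by \<open>\<gamma>\<close>, so each Cauchy
  product coefficient is a finite sum.\<close>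

lemma finite_restrict_add_fibre:
  fixes \<gamma> :: "'a::euclidean_space \<Rightarrow> nat"
  shows "finite {p \<in> multi_indices \<times> multi_indices. (case p of (\<alpha>, \<beta>) \<Rightarrow> \<lambda>b\<in>Basis. \<alpha> b + \<beta> b) = \<gamma>}"
    (is "finite ?F")
proof (rule finite_subset)
  show "finite ((\<Pi>\<^sub>E b\<in>Basis. {..\<gamma> b}) \<times> (\<Pi>\<^sub>E b\<in>(Basis::'a set). {..\<gamma> b}))"
    by (intro finite_cartesian_product finite_PiE) auto
  show "?F \<subseteq> (\<Pi>\<^sub>E b\<in>Basis. {..\<gamma> b}) \<times> (\<Pi>\<^sub>E b\<in>Basis. {..\<gamma> b})"
  proof (rule subrelI)
    fix \<alpha> \<beta> assume p: "(\<alpha>, \<beta>) \<in> ?F"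
    then have "(\<lambda>b\<in>Basis. \<alpha> b + \<beta> b) = \<gamma>" by simp
    then have "\<alpha> b + \<beta> b = \<gamma> b" if "b \<in> Basis" for b
      using that by (metis restrict_apply')
    then have "\<alpha> b \<le> \<gamma> b" "\<beta> b \<le> \<gamma> b" if "b \<in> Basis" for b
      using that by (metis le_add1, metis le_add2)
    with p show "(\<alpha>, \<beta>) \<in> (\<Pi>\<^sub>E b\<in>Basis. {..\<gamma> b}) \<times> (\<Pi>\<^sub>E b\<in>Basis. {..\<gamma> b})"
      by (simp add: PiE_iff)
  qed
qed

lemma real_analytic_on_scaleR:
  fixes f :: "'a::euclidean_space \<Rightarrow> real" and g :: "'a \<Rightarrow> 'b::euclidean_space"
  assumes "real_analytic_on f S" "real_analytic_on g S"
  shows "real_analytic_on (\<lambda>x. f x *\<^sub>R g x) S"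
  unfolding real_analytic_on_iff
proof
  fix x assume x: "x \<in> S"
  obtain r c where r: "r > 0"
    "\<And>y. y \<in> S \<inter> ball x r \<Longrightarrow> ((\<lambda>\<alpha>. monomial \<alpha> (y - x) *\<^sub>R c \<alpha>) has_sum f y) multi_indices"
    using assms(1) x unfolding real_analytic_on_iff by metis
  obtain s d where s: "s > 0"
    "\<And>y. y \<in> S \<inter> ball x s \<Longrightarrow> ((\<lambda>\<alpha>. monomial \<alpha> (y - x) *\<^sub>R d \<alpha>) has_sum g y) multi_indices"
    using assms(2) x unfolding real_analytic_on_iff by metis
  define e where "e = (\<lambda>(\<alpha>, \<beta>). \<lambda>b\<in>(Basis::'a set). \<alpha> b + \<beta> b :: nat)"
  \<comment> \<open>Coefficients of the Cauchy product.\<close>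
  define C where "C \<gamma> = (\<Sum>p\<in>{p \<in> multi_indices \<times> multi_indices. e p = \<gamma>}. c (fst p) *\<^sub>R d (snd p))" for \<gamma>
  have "((\<lambda>\<gamma>. monomial \<gamma> (y - x) *\<^sub>R C \<gamma>) has_sum f y *\<^sub>R g y) multi_indices"
    if y: "y \<in> S \<inter> ball x (min r s)" for y
    unfolding C_def
  proof (rule has_sum_regroup)
    have mon: "monomial (e (\<alpha>, \<beta>)) z = monomial \<alpha> z * monomial \<beta> z" for \<alpha> \<beta> and z :: 'a
      by (simp add: e_def monomial_def power_add prod.distrib)
    have "((\<lambda>(\<alpha>, \<beta>). (monomial \<alpha> (y - x) *\<^sub>R c \<alpha>) *\<^sub>R monomial \<beta> (y - x) *\<^sub>R d \<beta>) has_sum f y *\<^sub>R g y)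
        (multi_indices \<times> multi_indices)"
      using y by (intro has_sum_scaleR_Times r(2) s(2)) auto
    also have "(\<lambda>(\<alpha>, \<beta>). (monomial \<alpha> (y - x) *\<^sub>R c \<alpha>) *\<^sub>R monomial \<beta> (y - x) *\<^sub>R d \<beta>)
        = (\<lambda>p. monomial (e p) (y - x) *\<^sub>R c (fst p) *\<^sub>R d (snd p))"
      by (rule ext, clarify) (simp add: mon mult_ac)
    finally show "((\<lambda>p. monomial (e p) (y - x) *\<^sub>R c (fst p) *\<^sub>R d (snd p)) has_sum f y *\<^sub>R g y)
        (multi_indices \<times> multi_indices)" .
    show "e ` (multi_indices \<times> multi_indices) \<subseteq> multi_indices"
      by (auto simp: e_def)
    show "finite {p \<in> multi_indices \<times> multi_indices. e p = \<gamma>}" for \<gamma>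
      unfolding e_def by (rule finite_restrict_add_fibre)
  qed
  with r(1) s(1) show "\<exists>r>0. \<exists>c. \<forall>y \<in> S \<inter> ball x r.
        ((\<lambda>\<alpha>. monomial \<alpha> (y - x) *\<^sub>R c \<alpha>) has_sum f y *\<^sub>R g y) multi_indices"
    by (intro exI[of _ "min r s"] conjI exI[of _ C]) auto
qed

lemma real_analytic_on_const: "real_analytic_on (\<lambda>x::'a::euclidean_space. k) S"
  unfolding real_analytic_on_iff
proof
  fix x :: 'a
  let ?z = "\<lambda>b\<in>(Basis::'a set). 0::nat"
  have "((\<lambda>\<alpha>. monomial \<alpha> (y - x) *\<^sub>R (if \<alpha> = ?z then k else 0)) has_sum k) multi_indices" for y
    by (rule has_sum_finite_neutralI[where B = "{?z}"]) (auto simp: monomial_def)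
  then show "\<exists>r>0. \<exists>c. \<forall>y \<in> S \<inter> ball x r.
        ((\<lambda>\<alpha>. monomial \<alpha> (y - x) *\<^sub>R c \<alpha>) has_sum k) multi_indices"
    by (intro exI[of _ 1] conjI exI[of _ "\<lambda>\<alpha>. if \<alpha> = ?z then k else 0"]) auto
qed

lemma real_analytic_on_sum:
  assumes "finite I" "\<And>i. i \<in> I \<Longrightarrow> real_analytic_on (f i) S"
  shows "real_analytic_on (\<lambda>x. \<Sum>i\<in>I. f i x) S"
  using assms by (induction I rule: finite_induct) (auto intro: real_analytic_on_const real_analytic_on_add)

lemma real_analytic_on_inner:
  fixes f g :: "'a::euclidean_space \<Rightarrow> 'b::euclidean_space"
  assumes "real_analytic_on f S" "real_analytic_on g S"
  shows "real_analytic_on (\<lambda>x. f x \<bullet> g x) S"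
proof -
  have "real_analytic_on (\<lambda>x. \<Sum>b\<in>Basis. (f x \<bullet> b) *\<^sub>R (g x \<bullet> b)) S"
    by (intro real_analytic_on_sum real_analytic_on_scaleR finite_Basis
        real_analytic_on_bounded_linear[OF bounded_linear_inner_left] assms)
  then show ?thesis by (subst euclidean_inner) simp
qed

text \<open>Here \<open>q\<close> is a coordinate projection and \<open>\<iota>\<close> embeds the coordinates that it keeps.\<close>

lemma real_analytic_projection:
  fixes q :: "'c::euclidean_space \<Rightarrow> 'a::euclidean_space"
  assumes f: "real_analytic_on f UNIV" and q: "\<And>x y. q (x - y) = q x - q y" "\<And>x. norm (q x) \<le> norm x"
    and \<iota>: "\<iota> ` Basis \<subseteq> Basis" "inj_on \<iota> Basis" "\<And>x b. b \<in> Basis \<Longrightarrow> x \<bullet> \<iota> b = q x \<bullet> b"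
  shows "real_analytic_on (\<lambda>x. f (q x)) UNIV"
  unfolding real_analytic_on_iff
proof
  fix x :: 'c
  obtain r c where r: "r > 0"
    "\<And>y. y \<in> ball (q x) r \<Longrightarrow> ((\<lambda>\<alpha>. monomial \<alpha> (y - q x) *\<^sub>R c \<alpha>) has_sum f y) multi_indices"
    using f unfolding real_analytic_on_iff by (metis IntI UNIV_I)
  \<comment> \<open>Multi-indices are extended by zero in the coordinates that \<open>q\<close>
    drops. As \<open>e\<close> is injective on multi-indices, \<open>C\<close> below is
    \<open>c\<close> transported along \<open>e\<close> and zero elsewhere.\<close>
  define e where "e \<alpha> = (\<lambda>b'\<in>Basis. if b' \<in> \<iota> ` Basis then \<alpha> (inv_into Basis \<iota> b') else (0::nat))" for \<alpha>
  have e: "e \<alpha> (\<iota> b) = \<alpha> b" if "b \<in> Basis" for \<alpha> b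
    using that \<iota> by (auto simp: e_def)
  have inj: "inj_on e multi_indices"
    by (rule inj_onI, rule PiE_ext, assumption, assumption) (metis e)
  define C where "C \<gamma> = (\<Sum>\<alpha>\<in>{\<alpha> \<in> multi_indices. e \<alpha> = \<gamma>}. c \<alpha>)" for \<gamma>
  have mon: "monomial (e \<alpha>) z = monomial \<alpha> (q z)" for \<alpha> z
  proof -
    have "monomial (e \<alpha>) z = (\<Prod>b\<in>\<iota> ` Basis. (z \<bullet> b) ^ e \<alpha> b)"
      unfolding monomial_def using \<iota>(1) by (intro prod.mono_neutral_right) (auto simp: e_def)
    also have "\<dots> = monomial \<alpha> (q z)"
      by (simp add: prod.reindex[OF \<iota>(2)] \<iota>(3) e monomial_def)
    finally show ?thesis .
  qed
  have "((\<lambda>\<gamma>. monomial \<gamma> (y - x) *\<^sub>R C \<gamma>) has_sum f (q y)) multi_indices" if "y \<in> ball x r" for y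
    unfolding C_def
  proof (rule has_sum_regroup)
    have "norm (q x - q y) < r" using that q(2)[of "x - y"] q(1)[of x y] by (simp add: dist_norm)
    then show "((\<lambda>\<alpha>. monomial (e \<alpha>) (y - x) *\<^sub>R c \<alpha>) has_sum f (q y)) multi_indices"
      using r(2)[of "q y"] by (simp add: mon q(1) dist_norm)
    show "e ` multi_indices \<subseteq> multi_indices" by (auto simp: e_def)
    show "finite {\<alpha> \<in> multi_indices. e \<alpha> = \<gamma>}" for \<gamma>
      using finite_vimage_IntI[OF _ inj, of "{\<gamma>}"] by (simp add: vimage_def Int_def conj_commute)
  qed
  with r(1) show "\<exists>r>0. \<exists>c. \<forall>y \<in> UNIV \<inter> ball x r.
        ((\<lambda>\<alpha>. monomial \<alpha> (y - x) *\<^sub>R c \<alpha>) has_sum f (q y)) multi_indices"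
    by (intro exI[of _ r] conjI exI[of _ C]) auto
qed

lemma real_analytic_fst:
  fixes f :: "'a::euclidean_space \<Rightarrow> 'b::real_normed_vector"
  assumes "real_analytic_on f UNIV"
  shows "real_analytic_on (\<lambda>p::'a \<times> 'c::euclidean_space. f (fst p)) UNIV"
  by (rule real_analytic_projection[OF assms, of fst "\<lambda>b. (b, 0)"])
    (auto simp: Basis_prod_def norm_fst_le inj_on_def inner_prod_def)

lemma real_analytic_snd:
  fixes f :: "'a::euclidean_space \<Rightarrow> 'b::real_normed_vector"
  assumes "real_analytic_on f UNIV"
  shows "real_analytic_on (\<lambda>p::'c::euclidean_space \<times> 'a. f (snd p)) UNIV"
  by (rule real_analytic_projection[OF assms, of snd "\<lambda>b. (0, b)"])
    (auto simp: Basis_prod_def norm_snd_le inj_on_def inner_prod_def)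

lemma real_analytic_exp: "real_analytic_on (\<lambda>t::real. exp (k * t)) UNIV"
  unfolding real_analytic_on_iff
proof
  fix x :: real
  \<comment> \<open>Taylor coefficients at \<open>x\<close>, from
    \<open>exp (k * y) = exp (k * x) * exp (k * (y - x))\<close>. The basis of the reals is
    \<open>{1}\<close>, so a multi-index is a single exponent.\<close>
  define c where "c \<alpha> = exp (k * x) * (k ^ \<alpha> 1 / fact (\<alpha> 1))" for \<alpha> :: "real \<Rightarrow> nat"
  define e where "e n = (\<lambda>b\<in>{1::real}. n::nat)" for n
  have bij: "bij_betw e UNIV multi_indices"
  proof (rule bij_betwI[where g = "\<lambda>\<alpha>. \<alpha> 1"])
    show "e (\<alpha> 1) = \<alpha>" if "\<alpha> \<in> multi_indices" for \<alpha>
      using that by (intro PiE_ext[of _ "{1::real}" "\<lambda>_. UNIV"]) (auto simp: e_def)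
  qed (auto simp: e_def)
  have "((\<lambda>\<alpha>. monomial \<alpha> (y - x) *\<^sub>R c \<alpha>) has_sum exp (k * y)) multi_indices" for y
  proof -
    have "((\<lambda>n. (k * (y - x)) ^ n /\<^sub>R fact n) has_sum exp (k * (y - x))) UNIV"
      by (intro norm_summable_imp_has_sum summable_norm_exp exp_converges)
    from has_sum_cmult_right[OF this, of "exp (k * x)"]
    have "((\<lambda>n. exp (k * x) * ((k * (y - x)) ^ n /\<^sub>R fact n)) has_sum exp (k * y)) UNIV"
      by (simp add: right_diff_distrib flip: exp_add)
    moreover have "exp (k * x) * ((k * (y - x)) ^ n /\<^sub>R fact n) = monomial (e n) (y - x) *\<^sub>R c (e n)" for n
      unfolding power_mult_distrib by (simp add: monomial_def c_def e_def divide_inverse)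
    ultimately have "((\<lambda>n. monomial (e n) (y - x) *\<^sub>R c (e n)) has_sum exp (k * y)) UNIV" by simp
    then show ?thesis
      using has_sum_reindex_bij_betw[OF bij, of "\<lambda>\<alpha>. monomial \<alpha> (y - x) *\<^sub>R c \<alpha>"] by simp
  qed
  then show "\<exists>r>0. \<exists>c. \<forall>y \<in> UNIV \<inter> ball x r.
        ((\<lambda>\<alpha>. monomial \<alpha> (y - x) *\<^sub>R c \<alpha>) has_sum exp (k * y)) multi_indices"
    by (intro exI[of _ 1] conjI exI[of _ c]) auto
qed

section \<open>Flows of Lipschitz vector fields\<close>

lemma indefinite_integral_has_vector_derivative:
  fixes h :: "real \<Rightarrow> 'a::banach"
  assumes "continuous_on UNIV h" "0 \<le> t"
  shows "((\<lambda>t. integral {0..t} h) has_vector_derivative h t) (at t within {0..})"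
proof -
  \<comment> \<open>The end point \<open>t + 1\<close> keeps \<open>t\<close> off the right
    boundary, so the compact interval can be exchanged for the half-line.\<close>
  have "((\<lambda>t. integral {0..t} h) has_vector_derivative h t) (at t within {0..t + 1})"
    using assms by (intro integral_has_vector_derivative) (auto intro: continuous_on_subset)
  also have "at t within {0..t + 1} = at t within {0..}"
    by (rule at_within_nhd[of _ "{..<t + 1}"]) auto
  finally show ?thesis .
qed

text \<open>Integrating growth at rate \<open>2 * L\<close> gains the factor
  \<open>1 / (2 * L)\<close>; against the Lipschitz constant \<open>L\<close> this leaves the
  contraction constant 1/2.\<close>

lemma norm_weighted_integral_le:
  fixes h :: "real \<Rightarrow> 'a::banach"
  assumes h: "continuous_on UNIV h" and "0 < L" "0 \<le> C" "0 \<le> t"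
    and bound: "\<And>s. 0 \<le> s \<Longrightarrow> norm (h s) \<le> C * exp (2 * L * s)"
  shows "norm (exp (- 2 * L * t) *\<^sub>R integral {0..t} h) \<le> C / (2 * L)"
proof -
  have "((\<lambda>s. C * exp (2 * L * s)) has_integral
      (C / (2 * L) * exp (2 * L * t) - C / (2 * L) * exp (2 * L * 0))) {0..t}"
    using assms(2,4)
    by (intro fundamental_theorem_of_calculus)
      (auto intro!: derivative_eq_intros simp flip: has_real_derivative_iff_has_vector_derivative)
  moreover have "h integrable_on {0..t}"
    by (intro integrable_continuous_real continuous_on_subset[OF h]) auto
  ultimately have "norm (integral {0..t} h) \<le> C / (2 * L) * exp (2 * L * t) - C / (2 * L)"
    using bound integral_norm_bound_integral[of h "{0..t}" "\<lambda>s. C * exp (2 * L * s)"]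
    by (auto simp: has_integral_iff)
  also have "\<dots> \<le> C / (2 * L) * exp (2 * L * t)" using assms by simp
  finally have "exp (- 2 * L * t) * norm (integral {0..t} h)
      \<le> exp (- 2 * L * t) * (C / (2 * L) * exp (2 * L * t))"
    by (intro mult_left_mono) auto
  also have "\<dots> = C / (2 * L)" by (simp add: exp_minus field_simps)
  finally show ?thesis by simp
qed

text \<open>
  Picard iteration for \<open>e\<^sup>-\<^sup>2\<^sup>L\<^sup>t (\<phi> t - a)\<close> in the space of bounded continuous functions: the
  exponential weight makes it a contraction on the whole half-line.
\<close>

lemma global_solution_exists:
  fixes W :: "'a::banach \<Rightarrow> 'a"
  assumes "0 < L" and lip: "\<And>x y. norm (W x - W y) \<le> L * norm (x - y)"
  shows "\<exists>\<phi>. \<phi> 0 = a \<and> (\<forall>t\<ge>0. (\<phi> has_vector_derivative W (\<phi> t)) (at t within {0..}))"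
proof -
  define h where "h g s = W (a + exp (2 * L * s) *\<^sub>R apply_bcontfun g s)" for g s
  \<comment> \<open>The cut-off \<open>max 0 t\<close> extends \<open>P g\<close> by zero to
    negative times, since bounded continuous functions live on the whole line here.\<close>
  define P where "P g t = exp (- 2 * L * max 0 t) *\<^sub>R integral {0..max 0 t} (h g)" for g t
  have "L-lipschitz_on UNIV W"
    using assms by (intro lipschitz_onI) (auto simp: dist_norm)
  then have W: "continuous_on UNIV W" by (rule lipschitz_on_continuous_on)
  have h: "continuous_on UNIV (h g)" for g
    unfolding h_def by (intro continuous_on_compose2[OF W] continuous_intros) auto
  have I: "continuous_on {0..} (\<lambda>t. integral {0..t} (h g))" for g
    using indefinite_integral_has_vector_derivative[OF h]
    by (meson atLeast_iff continuous_on_eq_continuous_within has_vector_derivative_continuous)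
  have "continuous_on UNIV (P g)" for g
    unfolding P_def by (intro continuous_intros continuous_on_compose2[OF I]) auto
  moreover have "norm (P g t) \<le> (norm (W a) + L * norm g) / (2 * L)" for g t
    unfolding P_def
  proof (rule norm_weighted_integral_le[OF h \<open>0 < L\<close>])
    fix s :: real assume "0 \<le> s"
    have "norm (h g s) \<le> norm (W a) + norm (h g s - W a)"
      by (metis add.commute norm_triangle_sub)
    also have "norm (h g s - W a) \<le> L * (exp (2 * L * s) * norm (apply_bcontfun g s))"
      using lip[of "a + exp (2 * L * s) *\<^sub>R apply_bcontfun g s" a] by (simp add: h_def)
    also have "\<dots> \<le> L * (exp (2 * L * s) * norm g)"
      using \<open>0 < L\<close> norm_bounded[of g s] by simp
    also have "norm (W a) \<le> norm (W a) * exp (2 * L * s)"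
      using \<open>0 < L\<close> \<open>0 \<le> s\<close> by (simp add: mult_le_cancel_left1)
    finally show "norm (h g s) \<le> (norm (W a) + L * norm g) * exp (2 * L * s)"
      by (simp add: algebra_simps)
  qed (use \<open>0 < L\<close> in auto)
  ultimately have bc: "P g \<in> bcontfun" for g by (rule bcontfun_normI)
  have "\<exists>!g. Bcontfun (P g) = g"
  proof (rule banach_fix_type[of "1 / 2"])
    show "\<forall>f g. dist (Bcontfun (P f)) (Bcontfun (P g)) \<le> 1 / 2 * dist f g"
    proof (intro allI dist_bound)
      fix f g t
      have int: "h g integrable_on {0..T}" for g T
        by (intro integrable_continuous_real continuous_on_subset[OF h]) auto
      have "dist (P f t) (P g t) = norm (exp (- 2 * L * max 0 t) *\<^sub>R integral {0..max 0 t} (\<lambda>s. h f s - h g s))"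
        by (simp add: P_def dist_norm integral_diff int scaleR_diff_right)
      also have "\<dots> \<le> (L * dist f g) / (2 * L)"
      proof (rule norm_weighted_integral_le)
        show "continuous_on UNIV (\<lambda>s. h f s - h g s)" by (intro continuous_intros h)
        fix s
        have "norm (h f s - h g s) \<le> L * (exp (2 * L * s) * dist (apply_bcontfun f s) (apply_bcontfun g s))"
          using lip[of "a + exp (2 * L * s) *\<^sub>R apply_bcontfun f s" "a + exp (2 * L * s) *\<^sub>R apply_bcontfun g s"]
          by (simp add: h_def dist_norm flip: scaleR_diff_right)
        also have "\<dots> \<le> L * (exp (2 * L * s) * dist f g)"
          using \<open>0 < L\<close> dist_bounded[of f s g] by simp
        finally show "norm (h f s - h g s) \<le> L * dist f g * exp (2 * L * s)" by (simp add: mult_ac)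
      qed (use \<open>0 < L\<close> in auto)
      finally show "dist (apply_bcontfun (Bcontfun (P f)) t) (apply_bcontfun (Bcontfun (P g)) t) \<le> 1 / 2 * dist f g"
        using \<open>0 < L\<close> by (simp add: Bcontfun_inverse[OF bc])
    qed
  qed auto
  then obtain g where "Bcontfun (P g) = g" by blast
  then have g: "apply_bcontfun g = P g" using Bcontfun_inverse[OF bc, of g] by simp
  define \<phi> where "\<phi> t = a + integral {0..t} (h g)" for t
  \<comment> \<open>The fixed point equation says that \<open>exp (2 * L * t)\<close> times
    \<open>g\<close> at \<open>t\<close> is the integral of \<open>h g\<close> up to
    \<open>t\<close>; this removes the weight.\<close>
  have "h g t = W (\<phi> t)" if "0 \<le> t" for t
    using that by (simp add: h_def[of g t] g P_def \<phi>_def flip: exp_add)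
  then have "(\<phi> has_vector_derivative W (\<phi> t)) (at t within {0..})" if "0 \<le> t" for t
    using indefinite_integral_has_vector_derivative[OF h[of g] that] that
    unfolding \<phi>_def by (auto intro!: derivative_eq_intros)
  then show ?thesis by (intro exI[of _ \<phi>]) (auto simp: \<phi>_def)
qed

lemma mvt_half_line:
  fixes f :: "real \<Rightarrow> real"
  assumes "0 \<le> t" "\<And>s. 0 \<le> s \<Longrightarrow> (f has_real_derivative f' s) (at s within {0..})"
  obtains s where "0 \<le> s" "s \<le> t" "f t - f 0 = t * f' s"
proof -
  have "\<exists>s\<in>{0..t}. f t - f 0 = (\<lambda>x. x * f' s) (t - 0)"
  proof (rule mvt_very_simple[OF assms(1)])
    show "(f has_derivative (\<lambda>x. x * f' s)) (at s within {0..t})" if "0 \<le> s" "s \<le> t" for s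
      using has_field_derivative_subset[OF assms(2)[OF that(1)], of "{0..t}"]
      by (auto simp: has_field_derivative_def mult_commute_abs)
  qed
  then show thesis using that by auto
qed

text \<open>Gronwall's estimate: the weighted squared norm \<open>E\<close> has nonpositive
  derivative. Squaring keeps it differentiable where \<open>y\<close> vanishes.\<close>

lemma norm_growth_bound:
  fixes y :: "real \<Rightarrow> 'a::real_inner"
  assumes "0 \<le> t" and y: "\<And>s. 0 \<le> s \<Longrightarrow> (y has_vector_derivative v s) (at s within {0..})"
    and v: "\<And>s. 0 \<le> s \<Longrightarrow> norm (v s) \<le> L * norm (y s)"
  shows "norm (y t) \<le> exp (L * t) * norm (y 0)"
proof -
  define E where "E s = exp (- 2 * L * s) * (y s \<bullet> y s)" for s
  have dE: "(E has_real_derivative exp (- 2 * L * s) * (2 * (y s \<bullet> v s) - 2 * L * (y s \<bullet> y s))) (at s within {0..})"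
    if "0 \<le> s" for s
  proof -
    have "((\<lambda>s. y s \<bullet> y s) has_real_derivative 2 * (y s \<bullet> v s)) (at s within {0..})"
      using has_derivative_inner[OF y[OF that, unfolded has_vector_derivative_def] y[OF that, unfolded has_vector_derivative_def]]
      by (simp add: has_field_derivative_def inner_commute algebra_simps mult_commute_abs)
    then show ?thesis
      unfolding E_def by (auto intro!: derivative_eq_intros simp: algebra_simps)
  qed
  obtain s where s: "0 \<le> s" "s \<le> t" "E t - E 0 = t * (exp (- 2 * L * s) * (2 * (y s \<bullet> v s) - 2 * L * (y s \<bullet> y s)))"
    by (rule mvt_half_line[OF assms(1) dE])
  have "y s \<bullet> v s \<le> norm (y s) * norm (v s)" by (rule norm_cauchy_schwarz)
  also have "\<dots> \<le> L * (y s \<bullet> y s)"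
    using mult_left_mono[OF v[OF s(1)] norm_ge_zero[of "y s"]]
    by (simp add: dot_square_norm power2_eq_square mult_ac)
  finally have "E t \<le> E 0" using s(3) assms(1)
    by (simp add: mult_nonneg_nonpos diff_le_0_iff_le[of "E t", symmetric] del: diff_le_0_iff_le)
  then have "y t \<bullet> y t \<le> exp (2 * L * t) * (y 0 \<bullet> y 0)"
    by (simp add: E_def exp_minus field_simps)
  then have "(norm (y t))\<^sup>2 \<le> (exp (L * t) * norm (y 0))\<^sup>2"
    by (simp add: dot_square_norm power_mult_distrib exp_double[symmetric] mult.assoc)
  then show ?thesis by (simp add: power2_le_iff_abs_le)
qed

locale lipschitz_flow =
  fixes W :: "'a::real_inner \<Rightarrow> 'a" and \<Phi> :: "'a \<Rightarrow> real \<Rightarrow> 'a" and L :: real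
  assumes flow_0: "\<Phi> a 0 = a"
    and flow_deriv: "0 \<le> t \<Longrightarrow> (\<Phi> a has_vector_derivative W (\<Phi> a t)) (at t within {0..})"
    and lip: "norm (W x - W y) \<le> L * norm (x - y)"
begin

text \<open>As \<open>W x = 0\<close>, the Lipschitz condition bounds the velocity by the distance
  to \<open>x\<close>. For \<open>a = x\<close> this makes \<open>x\<close> stationary; for nearby
  \<open>a\<close> it controls the linearization error.\<close>

lemma flow_near_fixed_point:
  assumes "W x = 0" "0 \<le> t"
  shows "norm (\<Phi> a t - x) \<le> exp (L * t) * norm (a - x)"
proof -
  have "((\<lambda>t. \<Phi> a t - x) has_vector_derivative W (\<Phi> a s)) (at s within {0..})" if "0 \<le> s" for s
    by (auto intro!: derivative_eq_intros flow_deriv[OF that])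
  moreover have "norm (W (\<Phi> a s)) \<le> L * norm (\<Phi> a s - x)" for s
    using lip[of _ x] assms(1) by simp
  ultimately show ?thesis
    using norm_growth_bound[OF assms(2), of "\<lambda>t. \<Phi> a t - x" "\<lambda>t. W (\<Phi> a t)" L] by (simp add: flow_0)
qed

lemma flow_fixed_point:
  assumes "W x = 0" "0 \<le> t"
  shows "\<Phi> x t = x"
  using flow_near_fixed_point[OF assms, of x] by simp

text \<open>
  Along an eigenvector \<open>e\<close> of the adjoint of the linearization, the coordinate \<open>(\<Phi> a t - x) \<bullet> e\<close>
  solves a scalar linear equation up to an error that is small relative to \<open>a - x\<close>.
\<close>

lemma flow_has_derivative_eigenvector:
  assumes x: "W x = 0" and A: "(W has_derivative A) (at x)" and e: "\<And>v. A v \<bullet> e = \<sigma> * (v \<bullet> e)" and "0 \<le> \<tau>"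
  shows "((\<lambda>a. \<Phi> a \<tau> \<bullet> e) has_derivative (\<lambda>v. exp (\<sigma> * \<tau>) * (v \<bullet> e))) (at x)"
  unfolding has_derivative_at_alt
proof (intro conjI allI impI)
  show "bounded_linear (\<lambda>v. exp (\<sigma> * \<tau>) * (v \<bullet> e))"
    by (intro bounded_linear_const_mult bounded_linear_inner_left)
  fix \<epsilon> :: real assume "0 < \<epsilon>"
  \<comment> \<open>The product of the factors in the error estimate below; the added 1 keeps it
    positive even for \<open>\<tau> = 0\<close> or \<open>e = 0\<close>.\<close>
  define C where "C = exp (\<sigma> * \<tau>) * \<tau> * exp (\<bar>\<sigma>\<bar> * \<tau>) * exp (\<bar>L\<bar> * \<tau>) * norm e + 1"
  have C: "C > 0" unfolding C_def using \<open>0 \<le> \<tau>\<close> by (intro add_nonneg_pos mult_nonneg_nonneg) auto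
  then obtain \<delta> where "\<delta> > 0" and \<delta>: "\<And>z. norm (z - x) < \<delta> \<Longrightarrow> norm (W z - A (z - x)) \<le> \<epsilon> / C * norm (z - x)"
    using A \<open>0 < \<epsilon>\<close> x unfolding has_derivative_at_alt by (metis diff_zero divide_pos_pos)
  show "\<exists>d>0. \<forall>a. norm (a - x) < d \<longrightarrow>
      norm (\<Phi> a \<tau> \<bullet> e - \<Phi> x \<tau> \<bullet> e - exp (\<sigma> * \<tau>) * ((a - x) \<bullet> e)) \<le> \<epsilon> * norm (a - x)"
  \<comment> \<open>Starting points this close to \<open>x\<close> remain within
    \<open>\<delta>\<close> of it up to time \<open>\<tau>\<close>.\<close>
  proof (intro exI[of _ "\<delta> / exp (\<bar>L\<bar> * \<tau>)"] conjI allI impI)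
    fix a assume a: "norm (a - x) < \<delta> / exp (\<bar>L\<bar> * \<tau>)"
    define Y where "Y t = \<Phi> a t - x" for t
    have Y: "norm (Y t) \<le> exp (\<bar>L\<bar> * \<tau>) * norm (a - x)" if "0 \<le> t" "t \<le> \<tau>" for t
    proof -
      have "L * t \<le> \<bar>L\<bar> * \<tau>" using that by (intro mult_mono) auto
      then show ?thesis
        using flow_near_fixed_point[OF x that(1), of a] unfolding Y_def
        by (elim order_trans) (auto intro!: mult_right_mono)
    qed
    \<comment> \<open>Integrating factor: the linear part cancels in the derivative of
      \<open>z\<close>, leaving only the remainder of the linearization.\<close>
    define z where "z t = exp (- \<sigma> * t) * (Y t \<bullet> e)" for t
    have dz: "(z has_real_derivative exp (- \<sigma> * t) * ((W (\<Phi> a t) - A (Y t)) \<bullet> e)) (at t within {0..})"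
      if "0 \<le> t" for t
    proof -
      have "((\<lambda>t. Y t \<bullet> e) has_real_derivative W (\<Phi> a t) \<bullet> e) (at t within {0..})"
        using bounded_linear.has_vector_derivative[OF bounded_linear_inner_left flow_deriv[OF that], of a e]
        unfolding Y_def
        by (auto simp: inner_diff_left has_real_derivative_iff_has_vector_derivative intro!: derivative_eq_intros)
      then show ?thesis
        unfolding z_def by (auto intro!: derivative_eq_intros simp: e inner_diff_left algebra_simps)
    qed
    obtain s where s: "0 \<le> s" "s \<le> \<tau>"
        "z \<tau> - z 0 = \<tau> * (exp (- \<sigma> * s) * ((W (\<Phi> a s) - A (Y s)) \<bullet> e))"
      by (rule mvt_half_line[OF \<open>0 \<le> \<tau>\<close> dz])
    have "norm (Y s) < \<delta>" using Y[OF s(1,2)] a by (simp add: pos_less_divide_eq mult.commute)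
    then have "norm (W (\<Phi> a s) - A (Y s)) \<le> \<epsilon> / C * norm (Y s)"
      using \<delta>[of "\<Phi> a s"] by (simp add: Y_def)
    also have "\<dots> \<le> \<epsilon> / C * (exp (\<bar>L\<bar> * \<tau>) * norm (a - x))"
      using Y[OF s(1,2)] C \<open>0 < \<epsilon>\<close> by (intro mult_left_mono) auto
    finally have r: "norm (W (\<Phi> a s) - A (Y s)) \<le> \<epsilon> / C * (exp (\<bar>L\<bar> * \<tau>) * norm (a - x))" .
    have "- \<sigma> * s \<le> \<bar>\<sigma>\<bar> * \<tau>" using s by (intro mult_mono) auto
    then have "\<bar>z \<tau> - z 0\<bar> \<le> \<tau> * (exp (\<bar>\<sigma>\<bar> * \<tau>) * (\<epsilon> / C * (exp (\<bar>L\<bar> * \<tau>) * norm (a - x)) * norm e))"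
      unfolding s(3) abs_mult using \<open>0 \<le> \<tau>\<close> r
      by (intro mult_mono order_trans[OF Cauchy_Schwarz_ineq2] mult_nonneg_nonneg mult_right_mono) auto
    then have "exp (\<sigma> * \<tau>) * \<bar>z \<tau> - z 0\<bar>
        \<le> exp (\<sigma> * \<tau>) * (\<tau> * (exp (\<bar>\<sigma>\<bar> * \<tau>) * (\<epsilon> / C * (exp (\<bar>L\<bar> * \<tau>) * norm (a - x)) * norm e)))"
      by (intro mult_left_mono) auto
    also have "\<dots> = (C - 1) * (\<epsilon> / C * norm (a - x))" by (simp add: C_def mult_ac)
    also have "\<dots> \<le> C * (\<epsilon> / C * norm (a - x))"
      using C \<open>0 < \<epsilon>\<close> by (intro mult_right_mono) auto
    also have "\<dots> = \<epsilon> * norm (a - x)" using C by simp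
    also have "exp (\<sigma> * \<tau>) * \<bar>z \<tau> - z 0\<bar> = \<bar>exp (\<sigma> * \<tau>) * (z \<tau> - z 0)\<bar>" by (simp add: abs_mult)
    also have "exp (\<sigma> * \<tau>) * (z \<tau> - z 0) = \<Phi> a \<tau> \<bullet> e - \<Phi> x \<tau> \<bullet> e - exp (\<sigma> * \<tau>) * ((a - x) \<bullet> e)"
      using flow_fixed_point[OF x \<open>0 \<le> \<tau>\<close>]
      by (simp add: z_def Y_def flow_0 inner_diff_left exp_minus right_diff_distrib flip: mult.assoc)
    finally show "norm (\<Phi> a \<tau> \<bullet> e - \<Phi> x \<tau> \<bullet> e - exp (\<sigma> * \<tau>) * ((a - x) \<bullet> e)) \<le> \<epsilon> * norm (a - x)"
      by simp
  qed (use \<open>\<delta> > 0\<close> in auto)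
qed

end

section \<open>Symmetric matrices and the space of jets\<close>

text \<open>A maximizer of the Rayleigh quotient on the unit sphere of \<open>V\<close> is an eigenvector.\<close>

lemma self_adjoint_eigenvector:
  fixes f :: "'a::euclidean_space \<Rightarrow> 'a"
  assumes f: "linear f" and sym: "\<And>x y. f x \<bullet> y = x \<bullet> f y"
    and V: "subspace V" "f ` V \<subseteq> V" "V \<noteq> {0}"
  obtains e m where "e \<in> V" "norm e = 1" "f e = m *\<^sub>R e"
proof -
  obtain v where v: "v \<in> V" "v \<noteq> 0" using V subspace_0 by blast
  define K where "K = sphere 0 1 \<inter> V"
  have "compact K" unfolding K_def by (intro compact_Int_closed compact_sphere closed_subspace V)
  moreover have "(1 / norm v) *\<^sub>R v \<in> K" using v V by (auto simp: K_def subspace_scale)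
  moreover have "continuous_on K (\<lambda>x. f x \<bullet> x)"
    by (intro continuous_intros linear_continuous_on linear_conv_bounded_linear[THEN iffD1] f)
  ultimately obtain e where e: "e \<in> K" and max: "\<And>x. x \<in> K \<Longrightarrow> f x \<bullet> x \<le> f e \<bullet> e"
    using continuous_attains_sup[of K "\<lambda>x. f x \<bullet> x"] by blast
  define m where "m = f e \<bullet> e"
  \<comment> \<open>\<open>P\<close> is positive semidefinite on \<open>V\<close> and its quadratic
    form vanishes at \<open>e\<close>; this forces \<open>P e = 0\<close>, the eigenvector
    equation.\<close>
  define P where "P x = m *\<^sub>R x - f x" for x
  have eV: "e \<in> V" "norm e = 1" using e by (auto simp: K_def)
  have PV: "P x \<in> V" if "x \<in> V" for x
    unfolding P_def using that V by (intro subspace_diff subspace_scale) auto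
  have Pnonneg: "0 \<le> P x \<bullet> x" if "x \<in> V" for x
  proof (cases "x = 0")
    case False
    then have "(1 / norm x) *\<^sub>R x \<in> K" using that V by (auto simp: K_def subspace_scale)
    then have "f x \<bullet> x / (norm x)\<^sup>2 \<le> m"
      using max by (force simp: m_def linear_cmul[OF f] power2_eq_square)
    then show ?thesis
      using False by (simp add: P_def inner_diff_left pos_divide_le_eq flip: power2_norm_eq_inner)
  qed (simp add: P_def)
  have Pe: "P e \<bullet> e = 0"
    using eV by (simp add: P_def inner_diff_left m_def flip: power2_norm_eq_inner)
  define w where "w = P e"
  have lin: "P (e - s *\<^sub>R w) = w - s *\<^sub>R P w" for s
    by (simp add: P_def w_def linear_diff[OF f] linear_add[OF f] linear_cmul[OF f] algebra_simps)
  have Psym: "P w \<bullet> e = w \<bullet> w"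
    using sym[of w e] by (simp add: w_def P_def algebra_simps)
  define a b where "a = w \<bullet> w" and "b = P w \<bullet> w"
  have "0 \<le> b" unfolding b_def w_def by (intro Pnonneg PV eV)
  \<comment> \<open>Positivity of the form at \<open>e - s *\<^sub>R w\<close> for arbitrarily small
    \<open>s > 0\<close> will force \<open>a = 0\<close>.\<close>
  have "2 * a \<le> s * b" if "0 < s" for s
  proof -
    have "0 \<le> P (e - s *\<^sub>R w) \<bullet> (e - s *\<^sub>R w)"
      unfolding w_def by (intro Pnonneg subspace_diff subspace_scale V PV eV)
    also have "\<dots> = s * (s * b - 2 * a)"
      unfolding lin using Pe Psym by (simp add: w_def a_def b_def algebra_simps)
    finally show ?thesis using that by (simp add: zero_le_mult_iff)
  qed
  moreover have "0 \<le> a" by (simp add: a_def)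
  ultimately have "a = 0"
  proof (rule_tac ccontr)
    assume *: "\<And>s. 0 < s \<Longrightarrow> 2 * a \<le> s * b" and "0 \<le> a" "a \<noteq> 0"
    \<comment> \<open>The choice \<open>s = a / (b + 1)\<close> gives \<open>s * b \<le> a\<close>
      and is safe for \<open>b = 0\<close>.\<close>
    then have "2 * a \<le> a / (b + 1) * b" using \<open>0 \<le> b\<close> by (intro *) auto
    also have "\<dots> \<le> a" using \<open>0 \<le> a\<close> \<open>0 \<le> b\<close> by (simp add: field_simps)
    finally show False using \<open>0 \<le> a\<close> \<open>a \<noteq> 0\<close> by simp
  qed
  then have "P e = 0" by (simp add: a_def w_def)
  then show thesis using that[of e m] eV by (simp add: P_def)
qed

text \<open>Induction on the dimension: by self-adjointness the orthogonal complement of an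
  eigenvector inside \<open>V\<close> is again invariant.\<close>

lemma self_adjoint_orthonormal_eigenbasis:
  fixes f :: "'a::euclidean_space \<Rightarrow> 'a"
  assumes f: "linear f" and sym: "\<And>x y. f x \<bullet> y = x \<bullet> f y"
    and "subspace V" "f ` V \<subseteq> V"
  shows "\<exists>B. finite B \<and> pairwise orthogonal B \<and> span B = V \<and> (\<forall>b\<in>B. norm b = 1 \<and> (\<exists>m. f b = m *\<^sub>R b))"
  using assms(3,4)
proof (induction "dim V" arbitrary: V rule: less_induct)
  case less
  show ?case
  proof (cases "V = {0}")
    case True
    then show ?thesis by (intro exI[of _ "{}"]) auto
  next
    case False
    then obtain e m where e: "e \<in> V" "norm e = 1" "f e = m *\<^sub>R e"
      using self_adjoint_eigenvector[OF f sym less.prems] by metis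
    define U where "U = {v \<in> V. v \<bullet> e = 0}"
    have U: "subspace U"
      using less.prems(1) by (auto simp: U_def subspace_def inner_add_left)
    have fU: "f ` U \<subseteq> U"
      using less.prems(2) e(3) sym by (auto simp: U_def)
    have ee: "e \<bullet> e = 1" using e(2) by (simp add: norm_eq_1)
    then have "e \<notin> U" by (simp add: U_def)
    moreover have "U \<subseteq> V" by (auto simp: U_def)
    ultimately have "U \<subset> V" using e(1) by blast
    then have "dim U < dim V"
      using less.prems(1) U by (metis dim_psubset span_eq_iff)
    then obtain B where B: "finite B" "pairwise orthogonal B" "span B = U"
        "\<forall>b\<in>B. norm b = 1 \<and> (\<exists>m. f b = m *\<^sub>R b)"
      using less.hyps[OF _ U fU] by blast
    have orth: "b \<bullet> e = 0" if "b \<in> B" for b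
      using span_base[OF that] B(3) by (auto simp: U_def)
    have "span (insert e B) = V"
    proof
      have "insert e B \<subseteq> V" using e(1) B(3) span_superset[of B] by (auto simp: U_def)
      then show "span (insert e B) \<subseteq> V" using less.prems(1) by (simp add: span_minimal)
      show "V \<subseteq> span (insert e B)"
      proof
        fix v assume "v \<in> V"
        then have "v - (v \<bullet> e) *\<^sub>R e \<in> U"
          using less.prems(1) e(1) ee by (auto simp: U_def subspace_diff subspace_scale inner_diff_left)
        then show "v \<in> span (insert e B)" using B(3) by (auto simp: span_insert)
      qed
    qed
    then show ?thesis
      using B(1,2,4) e(2,3) orth
      by (intro exI[of _ "insert e B"]) (auto simp: pairwise_insert orthogonal_def inner_commute)
  qed
qed

section \<open>Orthogonal diagonalization of symmetric matrices\<close>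

definition diagonal :: "('n \<Rightarrow> real) \<Rightarrow> real^'n^'n" where
  "diagonal d = (\<chi> i j. if i = j then d i else 0)"

lemma diagonal_vector_mult: "diagonal d *v v = (\<chi> i. d i * v $ i)"
  by (simp add: diagonal_def matrix_vector_mult_def if_distrib[where f = "\<lambda>c. c * _"] cong: if_cong)

text \<open>The orthonormal eigenbasis has \<open>CARD('n)\<close> elements, so it can be indexed by
  \<open>'n\<close> and taken as the columns of \<open>Q\<close>.\<close>

theorem symmetric_matrix_diagonalization:
  fixes A :: "real^'n^'n"
  assumes "transpose A = A"
  obtains Q d where "orthogonal_matrix Q" "A = Q ** diagonal d ** transpose Q"
proof -
  have sym: "(A *v x) \<bullet> y = x \<bullet> (A *v y)" for x y
    using dot_lmul_matrix[of x A y] assms by (metis vector_transpose_matrix)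
  obtain B where B: "finite B" "pairwise orthogonal B" "span B = UNIV"
      "\<forall>b\<in>B. norm b = 1 \<and> (\<exists>m. A *v b = m *\<^sub>R b)"
    using self_adjoint_orthonormal_eigenbasis[of "(*v) A" UNIV] sym by auto
  have "independent B"
    using B(2,4) by (intro pairwise_orthogonal_independent) auto
  then have "card B = CARD('n)"
    using B(3) dim_eq_card_independent[of B] by (metis dim_UNIV dim_span DIM_cart DIM_real mult.right_neutral)
  then obtain q :: "'n \<Rightarrow> real^'n" where q: "bij_betw q UNIV B"
    using B(1) finite_same_card_bij[of "UNIV :: 'n set" B] by auto
  define Q where "Q = (\<chi> i j. q j $ i)"
  have col: "column j Q = q j" for j by (simp add: Q_def column_def)
  have qB: "q j \<in> B" for j using q bij_betwE by blast
  then have "\<forall>j. \<exists>m. A *v q j = m *\<^sub>R q j" using B(4) by blast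
  then obtain d where d: "\<And>j. A *v q j = d j *\<^sub>R q j" by metis
  have "orthogonal_matrix Q"
    unfolding orthogonal_matrix_orthonormal_columns col
    using B(2,4) qB inj_eq[OF bij_betw_imp_inj_on[OF q]] by (auto simp: pairwise_def)
  moreover have "A ** Q = Q ** diagonal d"
  proof -
    have "(A ** Q) $ i $ j = (A *v q j) $ i" for i j
      by (simp add: matrix_matrix_mult_def matrix_vector_mult_def Q_def)
    moreover have "(Q ** diagonal d) $ i $ j = q j $ i * d j" for i j
      by (simp add: matrix_matrix_mult_def diagonal_def Q_def if_distrib[where f = "\<lambda>c. _ * c"] cong: if_cong)
    ultimately show ?thesis by (simp add: d vec_eq_iff mult.commute)
  qed
  ultimately show thesis
    using that[of Q d] by (metis matrix_mul_assoc matrix_mul_rid orthogonal_matrix_def)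
qed

text \<open>This is \<open>Q ** transpose Q = mat 1\<close> read columnwise. It reassembles the flow
  from its eigencoordinates.\<close>

lemma orthogonal_matrix_expand:
  fixes Q :: "real^'n^'n"
  assumes "orthogonal_matrix Q"
  shows "(\<Sum>i\<in>UNIV. (y \<bullet> column i Q) *\<^sub>R column i Q) = y"
proof -
  have "Q *v (transpose Q *v y) = y"
    using assms by (simp add: matrix_vector_mul_assoc orthogonal_matrix_def del: transpose_matrix_vector)
  moreover have "(transpose Q *v y) $ i = y \<bullet> column i Q" for i
    by (simp add: matrix_vector_mul_component transpose_def column_def inner_commute)
  ultimately show ?thesis
    by (simp add: matrix_mult_sum scalar_mult_eq_scaleR)
qed

text \<open>Has the form of the eigenvector hypothesis in
  \<open>flow_has_derivative_eigenvector\<close>, and serves both the linearization and its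
  exponential.\<close>

lemma conj_diagonal_inner_column:
  assumes "orthogonal_matrix Q"
  shows "((Q ** diagonal d ** transpose Q) *v v) \<bullet> column i Q = d i * (v \<bullet> column i Q)"
proof -
  have inner: "w \<bullet> column i Q = (transpose Q *v w) $ i" for w
    by (simp add: matrix_vector_mul_component transpose_def column_def inner_commute)
  have "transpose Q *v ((Q ** diagonal d ** transpose Q) *v v) = diagonal d *v (transpose Q *v v)"
    using assms unfolding orthogonal_matrix_def
    by (metis matrix_vector_mul_assoc matrix_vector_mul_lid)
  then show ?thesis by (simp add: inner diagonal_vector_mult)
qed

lemma transpose_conj_diagonal: "transpose (Q ** diagonal d ** transpose Q) = Q ** diagonal d ** transpose Q"
proof -
  have "transpose (diagonal d) = diagonal d" by (auto simp: diagonal_def transpose_def vec_eq_iff)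
  then show ?thesis by (simp add: matrix_transpose_mul matrix_mul_assoc)
qed

lemma det_conj_diagonal:
  assumes "orthogonal_matrix Q"
  shows "det (Q ** diagonal d ** transpose Q) = (\<Prod>i\<in>UNIV. d i)"
proof -
  have "det Q * det (transpose Q) = 1"
    using assms by (metis det_mul det_I orthogonal_matrix_def)
  moreover have "det (diagonal d) = (\<Prod>i\<in>UNIV. d i)"
    by (subst det_diagonal) (auto simp: diagonal_def)
  ultimately show ?thesis by (simp add: det_mul)
qed

lemma trace_conj_diagonal:
  assumes "orthogonal_matrix Q"
  shows "trace (Q ** diagonal d ** transpose Q) = (\<Sum>i\<in>UNIV. d i)"
proof -
  have "trace (Q ** diagonal d ** transpose Q) = trace (diagonal d)"
    using assms by (metis matrix_mul_assoc matrix_mul_rid orthogonal_matrix_def trace_mul_sym)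
  then show ?thesis by (simp add: trace_def diagonal_def)
qed

text \<open>The codomain \<open>(R^3 + Sym_0(3))^k\<close> of the jet map, as a subspace of the
  larger type of its values.\<close>

definition jet_space :: "(((real^3) \<times> (real^3^3))^'k) set" where
  "jet_space = {v. \<forall>l. transpose (snd (v $ l)) = snd (v $ l) \<and> trace (snd (v $ l)) = 0}"

lemma subspace_jet_space: "subspace jet_space"
  by (auto simp: jet_space_def subspace_def transpose_def trace_def vec_eq_iff sum.distrib
      simp flip: sum_distrib_left)

text \<open>Per point there are 3 + 5 free coordinates: the vector, and the entries 11, 12, 13, 22,
  23 read off by \<open>h\<close>. Symmetry and zero trace determine the other four entries, so
  \<open>h\<close> is injective on the space.\<close>

lemma dim_jet_space_le: "dim (jet_space :: (((real^3) \<times> (real^3^3))^'k) set) \<le> 8 * CARD('k)"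
  (is "dim ?V \<le> _")
proof -
  define h :: "((real^3) \<times> (real^3^3))^'k \<Rightarrow> ((real^3) \<times> (real^3) \<times> (real^2))^'k"
    where "h v = (\<chi> l. (fst (v $ l), vector [snd (v $ l) $ 1 $ 1, snd (v $ l) $ 1 $ 2, snd (v $ l) $ 1 $ 3],
      vector [snd (v $ l) $ 2 $ 2, snd (v $ l) $ 2 $ 3]))" for v
  have h: "linear h"
    by (rule linearI) (auto simp: h_def vec_eq_iff forall_3 forall_2 prod_eq_iff)
  have V: "subspace ?V" by (rule subspace_jet_space)
  have inj: "inj_on h ?V"
  proof (rule linear_injective_on_subspace_0[OF h V, THEN iffD2], intro ballI impI)
    fix v assume v: "v \<in> ?V" and "h v = 0"
    then have *: "h v $ l = 0" for l by simp
    show "v = 0"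
    proof (subst vec_eq_iff, intro allI)
      fix l
      let ?A = "snd (v $ l)"
      have A: "transpose ?A = ?A" "trace ?A = 0" using v by (auto simp: jet_space_def)
      have sym: "?A $ i $ j = ?A $ j $ i" for i j
        using arg_cong[OF A(1), of "\<lambda>B. B $ j $ i"] by (simp add: transpose_def)
      have h0: "fst (v $ l) = 0" "vector [?A $ 1 $ 1, ?A $ 1 $ 2, ?A $ 1 $ 3] = (0 :: real^3)"
          "vector [?A $ 2 $ 2, ?A $ 2 $ 3] = (0 :: real^2)"
        using *[of l] by (simp_all add: h_def zero_prod_def)
      have "?A $ 1 $ 1 = 0" "?A $ 1 $ 2 = 0" "?A $ 1 $ 3 = 0" "?A $ 2 $ 2 = 0" "?A $ 2 $ 3 = 0"
        using h0(2,3) unfolding vec_eq_iff forall_3 forall_2 by simp_all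
      moreover from this have "?A $ 3 $ 3 = 0" using A(2) by (simp add: trace_def sum_3)
      ultimately have "?A = 0"
        using sym[of 2 1] sym[of 3 1] sym[of 3 2] by (simp add: vec_eq_iff forall_3)
      with h0(1) show "v $ l = 0 $ l" by (simp add: prod_eq_iff)
    qed
  qed
  have "dim ?V = dim (h ` ?V)"
    using dim_image_eq[OF h, of ?V] inj V by (simp add: span_eq_iff[THEN iffD2])
  also have "\<dots> \<le> DIM(((real^3) \<times> (real^3) \<times> (real^2))^'k)" by (rule dim_subset_UNIV)
  also have "\<dots> = 8 * CARD('k)" by simp
  finally show ?thesis .
qed

section \<open>Beltrami fields\<close>

lemma partial_eqI: "(f has_derivative f') (at x) \<Longrightarrow> partial i f x = f' (axis i 1)"
  unfolding partial_def using frechet_derivative_at by metis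

lemma partial_add:
  assumes "f differentiable (at x)" "g differentiable (at x)"
  shows "partial i (\<lambda>x. f x + g x) x = partial i f x + partial i g x"
  using has_derivative_add[OF assms[unfolded frechet_derivative_works]]
  by (subst partial_eqI) (auto simp: partial_def)

lemma partial_scaleR:
  assumes "f differentiable (at x)"
  shows "partial i (\<lambda>x. c *\<^sub>R f x) x = c *\<^sub>R partial i f x"
  using has_derivative_scaleR_right[OF assms[unfolded frechet_derivative_works]]
  by (subst partial_eqI) (auto simp: partial_def)

lemma differentiable_has_derivative_partial:
  assumes "f differentiable (at x)"
  shows "(f has_derivative (\<lambda>v. \<Sum>i\<in>UNIV. (v $ i) *\<^sub>R partial i f x)) (at x)"
proof -
  let ?D = "frechet_derivative f (at x)"
  have D: "(f has_derivative ?D) (at x)" using assms by (simp add: frechet_derivative_works)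
  have "?D v = (\<Sum>i\<in>UNIV. (v $ i) *\<^sub>R partial i f x)" for v
  proof -
    have "?D v = ?D (\<Sum>i\<in>UNIV. (v $ i) *\<^sub>R axis i 1)"
      using basis_expansion[of v] by (simp add: scalar_mult_eq_scaleR)
    also have "\<dots> = (\<Sum>i\<in>UNIV. (v $ i) *\<^sub>R partial i f x)"
      using has_derivative_linear[OF D] by (simp add: linear_sum linear_cmul partial_def)
    finally show ?thesis .
  qed
  then have "?D = (\<lambda>v. \<Sum>i\<in>UNIV. (v $ i) *\<^sub>R partial i f x)" by (rule ext)
  with D show ?thesis by simp
qed

text \<open>Differentiates a pointwise linear relation. Three components with constant coefficients
  fit both a component of the curl equation and the divergence.\<close>

lemma partial_linear_relation:
  fixes f g h :: "real^3 \<Rightarrow> real^3"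
  assumes "f differentiable (at x)" "g differentiable (at x)" "h differentiable (at x)"
    and rel: "\<And>x. a * f x $ i + b * g x $ j + c * h x $ m = 0"
  shows "a * partial k f x $ i + b * partial k g x $ j + c * partial k h x $ m = 0"
proof -
  let ?D = "\<lambda>f. frechet_derivative f (at x)"
  have "((\<lambda>x. a * f x $ i + b * g x $ j + c * h x $ m) has_derivative
      (\<lambda>v. a * ?D f v $ i + b * ?D g v $ j + c * ?D h v $ m)) (at x)"
    using assms(1-3) unfolding frechet_derivative_works
    by (intro has_derivative_add has_derivative_mult_right bounded_linear.has_derivative[OF bounded_linear_vec_nth])
  moreover have "((\<lambda>x. a * f x $ i + b * g x $ j + c * h x $ m) has_derivative (\<lambda>v. 0)) (at x)"
    unfolding rel by simp
  ultimately have "(\<lambda>v. a * ?D f v $ i + b * ?D g v $ j + c * ?D h v $ m) = (\<lambda>v. 0)"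
    by (rule has_derivative_unique)
  then show ?thesis unfolding partial_def by (rule fun_cong)
qed

lemma real_analytic_partial:
  fixes f :: "real^3 \<Rightarrow> 'b::euclidean_space"
  assumes "real_analytic_on f UNIV"
  shows "real_analytic_on (partial i f) UNIV"
  unfolding partial_def[abs_def] using assms by (rule real_analytic_directional_derivative) simp

lemma partial_commute:
  fixes f :: "real^3 \<Rightarrow> 'b::euclidean_space"
  assumes "real_analytic_on f UNIV"
  shows "partial i (partial j f) x = partial j (partial i f) x"
  unfolding partial_def[abs_def] by (rule real_analytic_mixed_derivatives[OF assms]) simp_all

text \<open>\<open>f\<close> is invariant under translation by \<open>x - y\<close>, so its
  derivatives at \<open>x\<close> and \<open>y\<close> coincide.\<close>

lemma torus_periodic_partial:
  assumes per: "torus_periodic f" and diff: "\<And>x. f differentiable (at x)"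
  shows "torus_periodic (partial i f)"
  unfolding torus_periodic_def
proof (intro allI impI)
  fix x y assume xy: "torus_eq x y"
  have "torus_eq (z + (x - y)) z" for z
    using xy by (simp add: torus_eq_def)
  then have "f = (\<lambda>z. f (z + (x - y)))"
    using per unfolding torus_periodic_def by metis
  moreover have "(f has_derivative frechet_derivative f (at x)) (at (y + (x - y)))"
    using diff[of x] by (simp add: frechet_derivative_works)
  then have "((\<lambda>z. f (z + (x - y))) has_derivative frechet_derivative f (at x)) (at y)"
    by (rule has_derivative_compose[rotated, where f = "\<lambda>z. z + (x - y)" and f' = "\<lambda>v. v", simplified])
      (auto intro!: derivative_eq_intros)
  ultimately have "(f has_derivative frechet_derivative f (at x)) (at y)" by simp
  then show "partial i f x = partial i f y"
    unfolding partial_def[of i f x] by (rule partial_eqI[symmetric])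
qed

lemma torus_periodic_bounded:
  fixes f :: "real^3 \<Rightarrow> 'b::real_normed_vector"
  assumes per: "torus_periodic f" and cont: "continuous_on UNIV f"
  obtains B where "0 \<le> B" "\<And>x. norm (f x) \<le> B"
proof -
  let ?K = "cbox 0 (\<chi> i. 2 * pi) :: (real^3) set"
  have "bounded (f ` ?K)"
    by (intro compact_imp_bounded compact_continuous_image continuous_on_subset[OF cont]) auto
  then obtain B where B: "\<And>x. x \<in> ?K \<Longrightarrow> norm (f x) \<le> B" by (auto simp: bounded_iff)
  have "norm (f x) \<le> B" for x
  proof -
    \<comment> \<open>Representative of \<open>x\<close> in the compact fundamental cube, where
      \<open>B\<close> bounds \<open>f\<close>.\<close>
    define y :: "real^3" where "y = (\<chi> i. x $ i - 2 * pi * of_int \<lfloor>x $ i / (2 * pi)\<rfloor>)"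
    have "torus_eq x y" by (auto simp: torus_eq_def y_def)
    moreover have "0 \<le> y $ i \<and> y $ i \<le> 2 * pi" for i
    proof -
      have "of_int \<lfloor>x $ i / (2 * pi)\<rfloor> \<le> x $ i / (2 * pi)" "x $ i / (2 * pi) \<le> of_int \<lfloor>x $ i / (2 * pi)\<rfloor> + 1"
        by linarith+
      then have "of_int \<lfloor>x $ i / (2 * pi)\<rfloor> * (2 * pi) \<le> x $ i" "x $ i \<le> (of_int \<lfloor>x $ i / (2 * pi)\<rfloor> + 1) * (2 * pi)"
        by (simp_all only: pos_le_divide_eq pos_divide_le_eq mult_pos_pos zero_less_numeral pi_gt_zero)
      then show ?thesis by (simp add: y_def algebra_simps)
    qed
    then have "y \<in> ?K" by (simp add: mem_box_cart)
    ultimately show ?thesis using B per unfolding torus_periodic_def by metis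
  qed
  moreover from this have "0 \<le> B" using norm_ge_zero order_trans by blast
  ultimately show thesis using that by blast
qed

lemma jacobian_component: "jacobian f (at x) $ j $ i = partial i f x $ j"
  by (simp add: jacobian_def matrix_def partial_def)

lemma jacobian_eqI:
  fixes A :: "real^'n^'m"
  shows "(f has_derivative (\<lambda>v. A *v v)) (at x) \<Longrightarrow> jacobian f (at x) = A"
  by (simp add: jacobian_def flip: frechet_derivative_at)

section \<open>Identities for a single Beltrami field\<close>

locale beltrami_field =
  fixes W :: "real^3 \<Rightarrow> real^3" and lam :: real
  assumes W: "W \<in> beltrami_space lam" and lam: "lam \<noteq> 0"
begin

lemma periodic: "torus_periodic W"
  and analytic: "real_analytic_on W UNIV"
  and curl_eq: "curl W x = lam *\<^sub>R W x"
  using W by (auto simp: beltrami_space_def)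

lemma differentiable: "W differentiable (at x)"
  by (rule real_analytic_imp_differentiable[OF analytic])

lemma partial_differentiable: "partial i W differentiable (at x)"
  by (rule real_analytic_imp_differentiable[OF real_analytic_partial[OF analytic]])

text \<open>The coefficients \<open>1\<close> and \<open>- 1\<close> are written out so that each
  identity matches the pattern of \<open>partial_linear_relation\<close>.\<close>

lemma curl_components:
  "lam * W x $ 1 + - 1 * partial 2 W x $ 3 + 1 * partial 3 W x $ 2 = 0"
  "lam * W x $ 2 + - 1 * partial 3 W x $ 1 + 1 * partial 1 W x $ 3 = 0"
  "lam * W x $ 3 + - 1 * partial 1 W x $ 2 + 1 * partial 2 W x $ 1 = 0"
  using curl_eq[of x] by (simp_all add: curl_def vec_eq_iff forall_3)

lemmas curl_components_partial =
  partial_linear_relation[OF differentiable partial_differentiable partial_differentiable curl_components(1)]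
  partial_linear_relation[OF differentiable partial_differentiable partial_differentiable curl_components(2)]
  partial_linear_relation[OF differentiable partial_differentiable partial_differentiable curl_components(3)]

lemmas commute = partial_commute[OF analytic]

text \<open>The divergence of a curl vanishes by equality of mixed derivatives, and
  \<open>lam\<close> can be divided out.\<close>

lemma divergence_zero: "divergence W x = 0"
proof -
  have "lam * (partial 1 W x $ 1 + partial 2 W x $ 2 + partial 3 W x $ 3) = 0"
    using curl_components_partial(1)[of 1 x] curl_components_partial(2)[of 2 x] curl_components_partial(3)[of 3 x]
      commute[of 1 2 x] commute[of 1 3 x] commute[of 2 3 x]
    by (simp add: algebra_simps)
  then show ?thesis using lam by (simp add: divergence_def sum_3)
qed

lemma divergence_partial:
  "1 * partial k (partial 1 W) x $ 1 + 1 * partial k (partial 2 W) x $ 2 + 1 * partial k (partial 3 W) x $ 3 = 0"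
  by (rule partial_linear_relation[OF partial_differentiable partial_differentiable partial_differentiable])
    (use divergence_zero in \<open>simp add: divergence_def sum_3\<close>)

text \<open>Componentwise form of curl curl = grad div - Laplacian: the left side is lam^2 W, and
  the divergence vanishes.\<close>

lemma laplacian_eq: "laplacian W x = - (lam\<^sup>2) *\<^sub>R W x"
proof -
  have "(\<Sum>i\<in>UNIV. partial i (partial i W) x $ j) = - (lam * (lam * W x $ j))" for j
  proof -
    note C = curl_components_partial[where x = x] and K = commute[where x = x]
      and D = divergence_partial[where x = x]
    have c: "lam * W x $ 1 = partial 2 W x $ 3 - partial 3 W x $ 2"
      "lam * W x $ 2 = partial 3 W x $ 1 - partial 1 W x $ 3"
      "lam * W x $ 3 = partial 1 W x $ 2 - partial 2 W x $ 1"
      using curl_components[of x] by simp_all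
    have E: "lam * (lam * W x $ 1) = lam * partial 2 W x $ 3 - lam * partial 3 W x $ 2"
      "lam * (lam * W x $ 2) = lam * partial 3 W x $ 1 - lam * partial 1 W x $ 3"
      "lam * (lam * W x $ 3) = lam * partial 1 W x $ 2 - lam * partial 2 W x $ 1"
      unfolding c by (simp_all only: right_diff_distrib)
    show ?thesis
      using exhaust_3[of j]
    proof (elim disjE)
      assume "j = 1"
      then show ?thesis
        using E(1) C(3)[of 2] C(2)[of 3] D[of 1] K[of 1 2] K[of 1 3] by (simp add: sum_3)
    next
      assume "j = 2"
      then show ?thesis
        using E(2) C(1)[of 3] C(3)[of 1] D[of 2] K[of 1 2] K[of 2 3] by (simp add: sum_3)
    next
      assume "j = 3"
      then show ?thesis
        using E(3) C(1)[of 2] C(2)[of 1] D[of 3] K[of 1 3] K[of 2 3] by (simp add: sum_3)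
    qed
  qed
  then show ?thesis by (simp add: laplacian_def vec_eq_iff power2_eq_square mult.assoc)
qed

text \<open>\<open>(W \<cdot> \<nabla>) W = \<nabla> (|W|\<^sup>2 / 2)\<close>, because \<open>(\<nabla> \<times> W) \<times> W = 0\<close>.\<close>

lemma advect_component: "advect W W x $ j = partial j W x \<bullet> W x"
proof -
  have C: "partial 2 W x $ 3 = partial 3 W x $ 2 + lam * W x $ 1"
    "partial 3 W x $ 1 = partial 1 W x $ 3 + lam * W x $ 2"
    "partial 1 W x $ 2 = partial 2 W x $ 1 + lam * W x $ 3"
    using curl_components[of x] by simp_all
  show ?thesis
    using exhaust_3[of j]
    by (elim disjE) (simp_all add: advect_def sum_3 inner_vec_def C algebra_simps)
qed

text \<open>The partial derivatives are continuous and periodic, hence bounded; the mean value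
  inequality turns the bounds into a global Lipschitz constant.\<close>

lemma lipschitz:
  obtains L where "0 < L" "\<And>x y. norm (W x - W y) \<le> L * norm (x - y)"
proof -
  have "\<exists>B\<ge>0. \<forall>x. norm (partial i W x) \<le> B" for i
  proof -
    have "continuous_on UNIV (partial i W)"
      by (simp add: continuous_on_eq_continuous_at differentiable_imp_continuous_within partial_differentiable)
    then show ?thesis
      using torus_periodic_bounded[OF torus_periodic_partial[OF periodic differentiable]] by metis
  qed
  then obtain B where B: "\<And>i. 0 \<le> B i" "\<And>i x. norm (partial i W x) \<le> B i" by metis
  define L where "L = (\<Sum>i\<in>UNIV. B i) + 1"
  have "norm (W x - W y) \<le> L * norm (x - y)" for x y
  proof (rule differentiable_bound[where S = UNIV])
    show "(W has_derivative (\<lambda>v. \<Sum>i\<in>UNIV. (v $ i) *\<^sub>R partial i W z)) (at z)" for z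
      by (rule differentiable_has_derivative_partial[OF differentiable])
    show "onorm (\<lambda>v. \<Sum>i\<in>UNIV. (v $ i) *\<^sub>R partial i W z) \<le> L" for z
    proof (rule onorm_bound)
      fix v :: "real^3"
      have "norm (\<Sum>i\<in>UNIV. (v $ i) *\<^sub>R partial i W z) \<le> (\<Sum>i\<in>UNIV. norm v * B i)"
        using B component_le_norm_cart[of v]
        by (intro order_trans[OF norm_sum] sum_mono) (auto intro!: mult_mono)
      also have "\<dots> \<le> L * norm v" by (simp add: L_def algebra_simps sum_distrib_left)
      finally show "norm (\<Sum>i\<in>UNIV. (v $ i) *\<^sub>R partial i W z) \<le> L * norm v" .
    qed (use B in \<open>simp add: L_def sum_nonneg\<close>)
  qed auto
  moreover have "0 < L" using B(1) by (simp add: L_def add_nonneg_pos sum_nonneg)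
  ultimately show thesis using that by blast
qed

text \<open>The Bernoulli pressure \<open>- |u|^2 / 2\<close> cancels the gradient nonlinearity;
  being quadratic in \<open>u\<close>, it carries the rate \<open>2 * \<mu>\<close>. What remains is
  the heat equation, which fixes \<open>\<mu>\<close>.\<close>

lemma analytic_decaying_solution:
  assumes \<mu>: "\<mu> = \<nu> * lam\<^sup>2"
  shows "analytic_fluid_solution \<nu> (\<lambda>x t. exp (- \<mu> * t) *\<^sub>R W x)
    (\<lambda>x t. - (1 / 2) * (exp (- (2 * \<mu>) * t) * (W x \<bullet> W x)))"
  unfolding analytic_fluid_solution_def
proof (intro conjI allI impI)
  have fstW: "real_analytic_on (\<lambda>p::(real^3) \<times> real. W (fst p)) UNIV"
    by (rule real_analytic_fst[OF analytic])
  have e: "real_analytic_on (\<lambda>p::(real^3) \<times> real. exp (k * snd p)) UNIV" for k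
    by (rule real_analytic_snd[OF real_analytic_exp])
  have "real_analytic_on (\<lambda>p. exp (- \<mu> * snd p) *\<^sub>R W (fst p)) UNIV"
    by (intro real_analytic_on_scaleR e fstW)
  then show "real_analytic_on (\<lambda>(x, t). exp (- \<mu> * t) *\<^sub>R W x) (UNIV \<times> {0..})"
    by (auto simp: case_prod_unfold elim: real_analytic_on_subset)
  have "real_analytic_on (\<lambda>p. (- (1 / 2)) *\<^sub>R (exp (- (2 * \<mu>) * snd p) *\<^sub>R (W (fst p) \<bullet> W (fst p)))) UNIV"
    by (intro real_analytic_on_bounded_linear[OF bounded_linear_scaleR_right]
        real_analytic_on_scaleR e fstW real_analytic_on_inner)
  then show "real_analytic_on (\<lambda>(x, t). - (1 / 2) * (exp (- (2 * \<mu>) * t) * (W x \<bullet> W x))) (UNIV \<times> {0..})"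
    by (auto simp: case_prod_unfold elim: real_analytic_on_subset)
next
  fix t :: real
  show "torus_periodic (\<lambda>x. exp (- \<mu> * t) *\<^sub>R W x)"
    "torus_periodic (\<lambda>x. - (1 / 2) * (exp (- (2 * \<mu>) * t) * (W x \<bullet> W x)))"
    using periodic unfolding torus_periodic_def by metis+
next
  fix x and t :: real assume "0 \<le> t"
  let ?E = "exp (- \<mu> * t)"
  have u: "partial i (\<lambda>y. ?E *\<^sub>R W y) = (\<lambda>y. ?E *\<^sub>R partial i W y)" for i
    by (rule ext) (rule partial_scaleR[OF differentiable])
  \<comment> \<open>Makes the derivative within the half-line unique, also at the end point
    \<open>t = 0\<close>.\<close>
  have "t islimpt {0..}"
    by (rule islimpt_subset[OF islimpt_greaterThanLessThan1[of t "t + 1"]]) (use \<open>0 \<le> t\<close> in auto)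
  then have "vector_derivative (\<lambda>t. exp (- \<mu> * t) *\<^sub>R W x) (at t within {0..}) = (- \<mu> * ?E) *\<^sub>R W x"
    by (intro vector_derivative_within)
      (auto simp: trivial_limit_within intro!: derivative_eq_intros)
  moreover have "advect (\<lambda>y. ?E *\<^sub>R W y) (\<lambda>y. ?E *\<^sub>R W y) x = (?E * ?E) *\<^sub>R advect W W x"
    unfolding advect_def u by (simp add: scaleR_sum_right mult_ac)
  moreover have "grad (\<lambda>y. - (1 / 2) * (exp (- (2 * \<mu>) * t) * (W y \<bullet> W y))) x = - (?E * ?E) *\<^sub>R advect W W x"
  proof -
    let ?D = "frechet_derivative W (at x)"
    have "((\<lambda>y. - (1 / 2) * (exp (- (2 * \<mu>) * t) * (W y \<bullet> W y))) has_derivative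
        (\<lambda>v. - (1 / 2) * (exp (- (2 * \<mu>) * t) * (W x \<bullet> ?D v + ?D v \<bullet> W x)))) (at x)"
      using differentiable[of x, unfolded frechet_derivative_works]
      by (intro has_derivative_mult_right has_derivative_inner)
    from partial_eqI[OF this] have "partial j (\<lambda>y. - (1 / 2) * (exp (- (2 * \<mu>) * t) * (W y \<bullet> W y))) x
        = - exp (- (2 * \<mu>) * t) * (partial j W x \<bullet> W x)" for j
      by (simp add: partial_def inner_commute)
    moreover have "exp (- (2 * \<mu>) * t) = ?E * ?E" by (simp flip: exp_add)
    ultimately show ?thesis by (simp add: grad_def vec_eq_iff advect_component)
  qed
  moreover have "laplacian (\<lambda>y. ?E *\<^sub>R W y) x = ?E *\<^sub>R laplacian W x"
    unfolding laplacian_def u by (simp add: partial_scaleR[OF partial_differentiable] scaleR_sum_right)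
  ultimately show "vector_derivative (\<lambda>t. exp (- \<mu> * t) *\<^sub>R W x) (at t within {0..})
      + advect (\<lambda>y. ?E *\<^sub>R W y) (\<lambda>y. ?E *\<^sub>R W y) x
      + grad (\<lambda>y. - (1 / 2) * (exp (- (2 * \<mu>) * t) * (W y \<bullet> W y))) x
      = \<nu> *\<^sub>R laplacian (\<lambda>y. ?E *\<^sub>R W y) x"
    by (simp add: laplacian_eq \<mu> mult_ac)
  show "divergence (\<lambda>y. ?E *\<^sub>R W y) x = 0"
    using divergence_zero[of x] unfolding divergence_def u by (simp flip: sum_distrib_left)
qed

end

section \<open>Jets of Beltrami fields\<close>

lemma beltrami_space_subspace:
  shows "(\<lambda>x. 0) \<in> beltrami_space lam"
    and "V \<in> beltrami_space lam \<Longrightarrow> W \<in> beltrami_space lam \<Longrightarrow> (\<lambda>x. V x + W x) \<in> beltrami_space lam"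
    and "W \<in> beltrami_space lam \<Longrightarrow> (\<lambda>x. c *\<^sub>R W x) \<in> beltrami_space lam"
proof -
  have "partial i (\<lambda>x. 0 :: real^3) x = 0" for i x
    by (rule partial_eqI[of _ "\<lambda>_. 0"]) simp
  then show "(\<lambda>x. 0) \<in> beltrami_space lam"
    by (auto simp: beltrami_space_def torus_periodic_def real_analytic_on_const curl_def vec_eq_iff forall_3)
next
  assume VW: "V \<in> beltrami_space lam" "W \<in> beltrami_space lam"
  then have "partial i (\<lambda>x. V x + W x) x = partial i V x + partial i W x" for i x
    by (intro partial_add real_analytic_imp_differentiable) (auto simp: beltrami_space_def)
  then have "curl (\<lambda>x. V x + W x) x = curl V x + curl W x" for x
    by (simp add: curl_def vec_eq_iff forall_3)
  moreover have "torus_periodic (\<lambda>x. V x + W x)"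
    using VW unfolding beltrami_space_def torus_periodic_def mem_Collect_eq by metis
  ultimately show "(\<lambda>x. V x + W x) \<in> beltrami_space lam"
    using VW by (auto simp: beltrami_space_def scaleR_add_right intro: real_analytic_on_add)
next
  assume W: "W \<in> beltrami_space lam"
  then have "partial i (\<lambda>x. c *\<^sub>R W x) x = c *\<^sub>R partial i W x" for i x
    by (intro partial_scaleR real_analytic_imp_differentiable) (auto simp: beltrami_space_def)
  then have "curl (\<lambda>x. c *\<^sub>R W x) x = c *\<^sub>R curl W x" for x
    by (simp add: curl_def vec_eq_iff forall_3 right_diff_distrib)
  moreover have "torus_periodic (\<lambda>x. c *\<^sub>R W x)"
    using W unfolding beltrami_space_def torus_periodic_def mem_Collect_eq by metis
  ultimately show "(\<lambda>x. c *\<^sub>R W x) \<in> beltrami_space lam"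
    using W by (auto simp: beltrami_space_def intro: real_analytic_on_bounded_linear[OF bounded_linear_scaleR_right])
qed

lemma beltrami_differentiable: "W \<in> beltrami_space lam \<Longrightarrow> W differentiable (at x)"
  by (auto simp: beltrami_space_def intro: real_analytic_imp_differentiable)

text \<open>Being a subspace, the image can be identified by containment and dimension
  alone.\<close>

lemma subspace_jet_image: "subspace (jet_map x ` beltrami_space lam)"
  unfolding subspace_def
proof (intro conjI ballI allI)
  have "partial i (\<lambda>x. 0 :: real^3) y = 0" for i y
    by (rule partial_eqI[of _ "\<lambda>_. 0"]) simp
  then have "jacobian (\<lambda>x. 0 :: real^3) (at y) = 0" for y :: "real^3"
    by (simp add: vec_eq_iff jacobian_component)
  then have "jet_map x (\<lambda>x. 0) = 0"
    by (simp add: jet_map_def vec_eq_iff sym_part_def transpose_def zero_prod_def)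
  then show "0 \<in> jet_map x ` beltrami_space lam"
    using beltrami_space_subspace(1) by (metis image_eqI)
next
  fix a b assume "a \<in> jet_map x ` beltrami_space lam" "b \<in> jet_map x ` beltrami_space lam"
  then obtain V W where VW: "V \<in> beltrami_space lam" "W \<in> beltrami_space lam" "a = jet_map x V" "b = jet_map x W"
    by blast
  have "jacobian (\<lambda>x. V x + W x) (at y) = jacobian V (at y) + jacobian W (at y)" for y
    using VW by (simp add: vec_eq_iff jacobian_component partial_add beltrami_differentiable)
  then have "a + b = jet_map x (\<lambda>x. V x + W x)"
    by (simp add: VW jet_map_def vec_eq_iff sym_part_def transpose_def algebra_simps)
  then show "a + b \<in> jet_map x ` beltrami_space lam"
    using beltrami_space_subspace(2)[OF VW(1,2)] by blast
next
  fix c a assume "a \<in> jet_map x ` beltrami_space lam"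
  then obtain W where W: "W \<in> beltrami_space lam" "a = jet_map x W" by blast
  have "jacobian (\<lambda>x. c *\<^sub>R W x) (at y) = c *\<^sub>R jacobian W (at y)" for y
    using W by (simp add: vec_eq_iff jacobian_component partial_scaleR beltrami_differentiable)
  then have "c *\<^sub>R a = jet_map x (\<lambda>x. c *\<^sub>R W x)"
    by (simp add: W jet_map_def vec_eq_iff sym_part_def transpose_def algebra_simps)
  then show "c *\<^sub>R a \<in> jet_map x ` beltrami_space lam"
    using beltrami_space_subspace(3)[OF W(1)] by blast
qed

text \<open>Symmetrization preserves the trace, and the trace of the Jacobian is the
  divergence.\<close>

lemma jet_image_subset:
  assumes "lam \<noteq> 0"
  shows "jet_map x ` beltrami_space lam \<subseteq> jet_space"
proof
  fix v assume "v \<in> jet_map x ` beltrami_space lam"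
  then obtain W where Wv: "W \<in> beltrami_space lam" "v = jet_map x W" by blast
  interpret beltrami_field W lam using Wv(1) assms by unfold_locales
  have "trace (jacobian W (at y)) = 0" for y
    using divergence_zero[of y] by (simp add: trace_def divergence_def jacobian_component)
  then have "trace (sym_part (jacobian W (at y))) = 0" for y
    by (simp add: trace_def sym_part_def transpose_def sum.distrib flip: sum_divide_distrib)
  moreover have "transpose (sym_part A) = sym_part A" for A
    by (simp add: sym_part_def transpose_def vec_eq_iff add.commute)
  ultimately show "v \<in> jet_space" by (simp add: jet_space_def Wv(2) jet_map_def)
qed

text \<open>Off \<open>Sigma_set\<close> the image has dimension at least
  \<open>8 * CARD('k)\<close>, and \<open>jet_space\<close> around it has at most that, so they
  coincide and the jet \<open>(0, S l)\<close> is attained.\<close>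

lemma jet_interpolation:
  fixes x :: "real^3^'k"
  assumes "x \<in> Conf - Sigma_set lam" and lam: "lam \<noteq> 0"
    and S: "\<And>l. transpose (S l) = S l" "\<And>l. trace (S l) = 0"
  obtains W where "W \<in> beltrami_space lam" "\<And>l. W (x $ l) = 0" "\<And>l. jacobian W (at (x $ l)) = S l"
proof -
  have "8 * CARD('k) \<le> dim (jet_map x ` beltrami_space lam)"
    using assms(1) by (auto simp: Sigma_set_def jet_rank_def)
  then have "jet_map x ` beltrami_space lam = jet_space"
    using dim_jet_space_le[where ?'k = 'k]
    by (intro subspace_dim_equal subspace_jet_image subspace_jet_space jet_image_subset lam) simp
  moreover have "(\<chi> l. (0, S l)) \<in> jet_space" using S by (simp add: jet_space_def)
  ultimately obtain W where Wv: "W \<in> beltrami_space lam" "(\<chi> l. (0, S l)) = jet_map x W" by blast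
  interpret beltrami_field W lam using Wv(1) lam by unfold_locales
  have "jet_map x W $ l = (0, S l)" for l by (simp flip: Wv(2))
  then have 0: "W (x $ l) = 0" and sym: "sym_part (jacobian W (at (x $ l))) = S l" for l
    by (simp_all add: jet_map_def)
  have "jacobian W (at (x $ l)) = S l" for l
  proof -
    have "transpose (jacobian W (at (x $ l))) = jacobian W (at (x $ l))"
      using curl_components[of "x $ l"] 0[of l]
      by (simp add: vec_eq_iff forall_3 transpose_def jacobian_component)
    then show ?thesis using sym[of l] by (simp add: sym_part_def flip: scaleR_2)
  qed
  with that[of W] Wv(1) 0 show thesis by blast
qed

section \<open>Prescribed Lagrangian deformation\<close>

text \<open>Each coordinate along a column of \<open>Q\<close> is differentiated separately; the
  expansion in columns recovers the whole flow map.\<close>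

lemma flow_has_derivative_conj_diagonal:
  fixes W :: "real^'n \<Rightarrow> real^'n"
  assumes "lipschitz_flow W \<Phi> L" and "W x = 0" "0 \<le> \<tau>" and Q: "orthogonal_matrix Q"
    and "(W has_derivative (\<lambda>v. (Q ** diagonal \<sigma> ** transpose Q) *v v)) (at x)"
  shows "((\<lambda>a. \<Phi> a \<tau>) has_derivative
    (\<lambda>v. (Q ** diagonal (\<lambda>i. exp (\<sigma> i * \<tau>)) ** transpose Q) *v v)) (at x)"
proof -
  interpret lipschitz_flow W \<Phi> L by fact
  let ?e = "\<lambda>i. column i Q" and ?G = "Q ** diagonal (\<lambda>i. exp (\<sigma> i * \<tau>)) ** transpose Q"
  have "((\<lambda>a. \<Phi> a \<tau> \<bullet> ?e i) has_derivative (\<lambda>v. (?G *v v) \<bullet> ?e i)) (at x)" for i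
    unfolding conj_diagonal_inner_column[OF Q]
    by (rule flow_has_derivative_eigenvector[OF assms(2,5) conj_diagonal_inner_column[OF Q] assms(3)])
  then have "((\<lambda>a. \<Sum>i\<in>UNIV. (\<Phi> a \<tau> \<bullet> ?e i) *\<^sub>R ?e i) has_derivative
      (\<lambda>v. \<Sum>i\<in>UNIV. ((?G *v v) \<bullet> ?e i) *\<^sub>R ?e i)) (at x)"
    by (intro has_derivative_sum has_derivative_scaleR_left)
  then show ?thesis by (simp only: orthogonal_matrix_expand[OF Q])
qed

text \<open>The inviscid clock is separate because the viscous formula divides by
  \<open>\<mu>\<close>. Positivity at positive times allows division by the value at
  \<open>T\<close> later.\<close>

lemma decaying_clock:
  fixes \<mu> :: real
  assumes "0 \<le> \<mu>"
  obtains s where "s 0 = 0" "\<And>t. (s has_real_derivative exp (- \<mu> * t)) (at t)"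
    "\<And>t. 0 \<le> t \<Longrightarrow> 0 \<le> s t" "\<And>t. 0 < t \<Longrightarrow> 0 < s t"
proof (cases "\<mu> = 0")
  case True
  then show thesis by (intro that[of "\<lambda>t. t"]) auto
next
  case False
  with assms show thesis
    by (intro that[of "\<lambda>t. (1 - exp (- \<mu> * t)) / \<mu>"]) (auto intro!: derivative_eq_intros)
qed

lemma sym_pos_def_diagonalization:
  assumes "sym_pos_def A"
  obtains Q d where "orthogonal_matrix Q" "A = Q ** diagonal d ** transpose Q" "\<And>i. 0 < d i"
proof -
  obtain Q d where Q: "orthogonal_matrix Q" and A: "A = Q ** diagonal d ** transpose Q"
    using symmetric_matrix_diagonalization assms unfolding sym_pos_def_def by metis
  have "0 < d i" for i
  proof -
    let ?e = "column i Q"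
    have e: "norm ?e = 1" using Q by (simp add: orthogonal_matrix_orthonormal_columns)
    then have "?e \<noteq> 0" by auto
    then have "0 < (A *v ?e) \<bullet> ?e" using assms by (simp add: sym_pos_def_def inner_commute)
    then show ?thesis using e by (simp add: A conj_diagonal_inner_column[OF Q] norm_eq_1)
  qed
  with Q A that show thesis by blast
qed

theorem corollary2p11:
  fixes T \<nu> :: real
  assumes "T > 0" and "\<nu> \<ge> 0"
  shows "\<forall>\<^sub>F lam::int in at_top. odd lam \<longrightarrow>
    (\<forall>(x :: real^3^'k) \<in> Conf - Sigma_set (of_int lam).
     \<forall>F :: 'k \<Rightarrow> real^3^3. (\<forall>l. sym_pos_def (F l) \<and> det (F l) = 1) \<longrightarrow>
       (\<exists>u p X. analytic_fluid_solution \<nu> u p \<and> lagrangian_flow u X \<and>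
          (\<forall>l. (\<forall>t\<in>{0..T}. X (x $ l) t = x $ l) \<and>
               (\<lambda>a. X a T) differentiable (at (x $ l)) \<and>
               jacobian (\<lambda>a. X a T) (at (x $ l)) = F l)))"
  unfolding eventually_at_top_linorder
\<comment> \<open>The threshold 1 secures \<open>lam \<noteq> 0\<close>.\<close>
proof (intro exI[of _ 1] allI ballI impI)
  fix lam :: int and x :: "real^3^'k" and F :: "'k \<Rightarrow> real^3^3"
  assume "1 \<le> lam" and x: "x \<in> Conf - Sigma_set (of_int lam)"
    and F: "\<forall>l. sym_pos_def (F l) \<and> det (F l) = 1"
  define \<mu> where "\<mu> = \<nu> * (of_int lam)\<^sup>2"
  have lam: "real_of_int lam \<noteq> 0" using \<open>1 \<le> lam\<close> by simp
  have "0 \<le> \<mu>" using assms(2) by (simp add: \<mu>_def)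
  then obtain s where s: "s 0 = 0" "\<And>t. (s has_real_derivative exp (- \<mu> * t)) (at t)"
      "\<And>t. 0 \<le> t \<Longrightarrow> 0 \<le> s t" "\<And>t. 0 < t \<Longrightarrow> 0 < s t"
    using decaying_clock by metis
  define \<tau> where "\<tau> = s T"
  have \<tau>: "0 < \<tau>" using s(4) assms(1) by (simp add: \<tau>_def)
  have "\<exists>Q d. orthogonal_matrix Q \<and> F l = Q ** diagonal d ** transpose Q \<and> (\<forall>i. 0 < d i)" for l
    using sym_pos_def_diagonalization F by metis
  then obtain Q d where Q: "\<And>l. orthogonal_matrix (Q l)"
      and Fl: "\<And>l. F l = Q l ** diagonal (d l) ** transpose (Q l)" and d: "\<And>l i. 0 < d l i"
    by metis
  define \<sigma> where "\<sigma> l i = ln (d l i) / \<tau>" for l i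
  define S where "S l = Q l ** diagonal (\<sigma> l) ** transpose (Q l)" for l
  have "trace (S l) = 0" for l
  proof -
    have "(\<Prod>i\<in>UNIV. d l i) = 1" using F Fl det_conj_diagonal[OF Q] by metis
    then have "(\<Sum>i\<in>UNIV. ln (d l i)) = 0" using d by (subst ln_prod[symmetric]) (auto simp: less_imp_neq[symmetric])
    then show ?thesis
      by (simp add: S_def trace_conj_diagonal[OF Q] \<sigma>_def flip: sum_divide_distrib)
  qed
  then obtain W where Wx: "W \<in> beltrami_space lam" "\<And>l. W (x $ l) = 0"
      "\<And>l. jacobian W (at (x $ l)) = S l"
    using jet_interpolation[OF x lam, of S] transpose_conj_diagonal unfolding S_def by metis
  interpret beltrami_field W lam using Wx(1) lam by unfold_locales
  obtain L where L: "0 < L" "\<And>x y. norm (W x - W y) \<le> L * norm (x - y)" using lipschitz by metis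
  obtain \<Phi> where \<Phi>: "\<And>a. \<Phi> a 0 = a"
      "\<And>a t. 0 \<le> t \<Longrightarrow> (\<Phi> a has_vector_derivative W (\<Phi> a t)) (at t within {0..})"
    using global_solution_exists[OF L] by metis
  then have flow: "lipschitz_flow W \<Phi> L" using L(2) by unfold_locales auto
  define u where "u x t = exp (- \<mu> * t) *\<^sub>R W x" for x t
  define X where "X a t = \<Phi> a (s t)" for a t
  have "analytic_fluid_solution \<nu> u (\<lambda>x t. - (1 / 2) * (exp (- (2 * \<mu>) * t) * (W x \<bullet> W x)))"
    unfolding u_def by (rule analytic_decaying_solution[OF \<mu>_def])
  moreover have "lagrangian_flow u X"
    unfolding lagrangian_flow_def
  proof (intro allI conjI impI)
    fix a and t :: real
    show "X a 0 = a" by (simp add: X_def s(1) \<Phi>(1))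
    assume t: "0 \<le> t"
    \<comment> \<open>The derivative of \<open>\<Phi> a\<close> is taken within the half-line, so
      the chain rule is applied within the range of the clock, which is nonnegative there.\<close>
    have "(\<Phi> a has_vector_derivative W (\<Phi> a (s t))) (at (s t) within s ` {0..})"
      using s(3) by (intro has_vector_derivative_within_subset[OF \<Phi>(2)[OF s(3)[OF t]]]) auto
    moreover have "(s has_vector_derivative exp (- \<mu> * t)) (at t within {0..})"
      using s(2)[of t] by (simp add: has_field_derivative_at_within flip: has_real_derivative_iff_has_vector_derivative)
    ultimately show "(X a has_vector_derivative u (X a t) t) (at t within {0..})"
      using vector_diff_chain_within[of s _ t "{0..}" "\<Phi> a"] by (simp add: X_def[abs_def] u_def o_def)
  qed
  moreover have "X (x $ l) t = x $ l" if "t \<in> {0..T}" for l t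
    using lipschitz_flow.flow_fixed_point[OF flow Wx(2)] that s(3) by (simp add: X_def)
  moreover have "((\<lambda>a. X a T) has_derivative (\<lambda>v. F l *v v)) (at (x $ l))" for l
  proof -
    have "(W has_derivative (\<lambda>v. S l *v v)) (at (x $ l))"
      using differentiable jacobian_works Wx(3) by metis
    then have "((\<lambda>a. \<Phi> a \<tau>) has_derivative
        (\<lambda>v. (Q l ** diagonal (\<lambda>i. exp (\<sigma> l i * \<tau>)) ** transpose (Q l)) *v v)) (at (x $ l))"
      using flow_has_derivative_conj_diagonal[OF flow Wx(2) _ Q] \<tau> unfolding S_def by (meson less_imp_le)
    moreover have "exp (\<sigma> l i * \<tau>) = d l i" for i using \<tau> d by (simp add: \<sigma>_def)
    ultimately show ?thesis by (simp add: Fl X_def \<tau>_def)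
  qed
  ultimately show "\<exists>u p X. analytic_fluid_solution \<nu> u p \<and> lagrangian_flow u X \<and>
      (\<forall>l. (\<forall>t\<in>{0..T}. X (x $ l) t = x $ l) \<and>
        (\<lambda>a. X a T) differentiable (at (x $ l)) \<and> jacobian (\<lambda>a. X a T) (at (x $ l)) = F l)"
    using jacobian_eqI unfolding differentiable_def by blast
qed

end
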